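(* There exist a smooth observable $f\in C^\infty(\mathbb T^2)$, a sequence of integers $N\to\infty$, and for each such $N$ a normalized Hecke eigenfunction $\psi_N\in\mathcal H_N$ such that \[\left|\langle \operatorname{Op}_N(f)\psi_N,\psi_N\rangle-\int_{\mathbb T^2}f\right|\gg N^{-1/3}.\]
   Context: Let $A\in \mathrm{SL}(2,\mathbb Z)$ be hyperbolic, $\alpha$ an eigenvalue of $A$, $\mathfrak O=\mathbb Z[\alpha]$, $\iota:\mathfrak O\to\mathrm{Mat}(2,\mathbb Z)$, $n+m\alpha\mapsto nI+mA$. For an integer $N$, $C(N)$ is the kernel of the map $(\mathfrak O/N\mathfrak O)^*\to(\mathbb Z/N\mathbb Z)^*$ induced by the field norm. $\mathcal H_N=L^2(\mathbb Z/N\mathbb Z)$ with $\langle\phi,\psi\rangle=\frac1N\sum_y\phi(y)\overline{\psi(y)}$; with $e_N(x)=e^{2\pi i x/N}$, $T_N(n)\psi(y)=e_{2N}(n_1n_2)e_N(n_2y)\psi(y+n_1)$ for $n\in\mathbb Z^2$, and $\operatorname{Op}_N(f)=\sum_n\hat f(n)T_N(n)$ for $f$ with Fourier coefficients $\hat f(n)$. For odd $N$, $U_N$ denotes the quantum-propagator (Weil) unitary representation of $\mathrm{SL}(2,\mathbb Z/N\mathbb Z)$ on $\mathcal H_N$ used in the Hannay–Berry/Kurlberg–Rudnick quantization of the cat map. A Hecke eigenfunction is a joint eigenfunction of $U_N(A)$ and all Hecke operators $U_N(\iota(\beta))$, $\beta\in C(N)$. *)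

theory Defs
  imports "HOL-Analysis.Analysis" "HOL-Number_Theory.Number_Theory"
begin

section \<open>Cat maps and the order generated by an eigenvalue\<close>

definition hyperbolic :: "int^2^2 \<Rightarrow> bool" where
  "hyperbolic A \<longleftrightarrow> \<bar>trace A\<bar> > 2"

definition is_eigenvalue :: "int^2^2 \<Rightarrow> real \<Rightarrow> bool" where
  "is_eigenvalue A \<alpha> \<longleftrightarrow> (\<exists>v::real^2. v \<noteq> 0 \<and> (\<chi> i j. real_of_int (A $ i $ j)) *v v = \<alpha> *\<^sub>R v)"

text \<open>
  For a hyperbolic matrix of determinant 1 the eigenvalues are real and irrational, so every
  element of the order $\mathbf{Z}[\alpha]$ is \<open>order_elem \<alpha> n m\<close> for unique integers \<open>n\<close>, \<open>m\<close>.
\<close>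

definition order_elem :: "real \<Rightarrow> int \<Rightarrow> int \<Rightarrow> real" where
  "order_elem \<alpha> n m = of_int n + of_int m * \<alpha>"

definition quad_order :: "real \<Rightarrow> real set" where
  "quad_order \<alpha> = {order_elem \<alpha> n m | n m. True}"

definition order_ideal :: "real \<Rightarrow> nat \<Rightarrow> real set" where
  "order_ideal \<alpha> N = {of_nat N * \<gamma> | \<gamma>. \<gamma> \<in> quad_order \<alpha>}"

text \<open>The Galois conjugate of \<open>\<alpha>\<close> is the other root \<open>trace A - \<alpha>\<close> of the characteristic polynomial.\<close>

definition field_norm :: "int^2^2 \<Rightarrow> real \<Rightarrow> int \<Rightarrow> int \<Rightarrow> real" where
  "field_norm A \<alpha> n m = order_elem \<alpha> n m * order_elem (of_int (trace A) - \<alpha>) n m"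

definition iota :: "int^2^2 \<Rightarrow> int \<Rightarrow> int \<Rightarrow> int^2^2" where
  "iota A n m = mat n + mat m ** A"

text \<open>
  The classes in \<open>C(N)\<close> are given by all their representatives \<open>n + m \<alpha>\<close>, as coordinate pairs:
  the class has to be a unit modulo \<open>N\<close>, and its norm has to be congruent to 1 modulo \<open>N\<close>.
\<close>

definition norm_kernel :: "int^2^2 \<Rightarrow> real \<Rightarrow> nat \<Rightarrow> (int \<times> int) set" where
  "norm_kernel A \<alpha> N =
     {(n, m). (\<exists>\<gamma>\<in>quad_order \<alpha>. order_elem \<alpha> n m * \<gamma> - 1 \<in> order_ideal \<alpha> N) \<and>
              (\<exists>k::int. field_norm A \<alpha> n m = 1 + of_int k * of_nat N)}"


section \<open>Observables on the torus\<close>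

primrec C_k :: "nat \<Rightarrow> ('a::real_normed_vector \<Rightarrow> 'b::real_normed_vector) \<Rightarrow> bool" where
  "C_k 0 f \<longleftrightarrow> continuous_on UNIV f"
| "C_k (Suc k) f \<longleftrightarrow>
     (\<forall>x. f differentiable (at x)) \<and> (\<forall>v. C_k k (\<lambda>x. frechet_derivative f (at x) v))"

definition torus_smooth :: "(real^2 \<Rightarrow> complex) \<Rightarrow> bool" where
  "torus_smooth f \<longleftrightarrow> (\<forall>k. C_k k f) \<and> (\<forall>x i. f (x + axis i 1) = f x)"

definition torus_integral :: "(real^2 \<Rightarrow> complex) \<Rightarrow> complex" where
  "torus_integral f = integral (cbox 0 1) f"

definition fourier_coeff :: "(real^2 \<Rightarrow> complex) \<Rightarrow> int^2 \<Rightarrow> complex" where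
  "fourier_coeff f n =
     torus_integral (\<lambda>x. f x * cis (- 2 * pi * ((\<chi> i. real_of_int (n $ i)) \<bullet> x)))"


section \<open>Quantum mechanics at level \<open>N\<close>\<close>

text \<open>Functions on the integers modulo \<open>N\<close> are \<open>N\<close>-periodic functions on the integers.\<close>

definition hilbert :: "nat \<Rightarrow> (int \<Rightarrow> complex) set" where
  "hilbert N = {\<psi>. \<forall>y. \<psi> (y + int N) = \<psi> y}"

definition inner_N :: "nat \<Rightarrow> (int \<Rightarrow> complex) \<Rightarrow> (int \<Rightarrow> complex) \<Rightarrow> complex" where
  "inner_N N \<phi> \<psi> = (1 / of_nat N) * (\<Sum>y\<in>{0..<int N}. \<phi> y * cnj (\<psi> y))"

definition e_N :: "nat \<Rightarrow> int \<Rightarrow> complex" where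
  "e_N N x = cis (2 * pi * of_int x / of_nat N)"

definition T_N :: "nat \<Rightarrow> int^2 \<Rightarrow> (int \<Rightarrow> complex) \<Rightarrow> (int \<Rightarrow> complex)" where
  "T_N N n \<psi> = (\<lambda>y. e_N (2 * N) (n $ 1 * n $ 2) * e_N N (n $ 2 * y) * \<psi> (y + n $ 1))"

definition Op_N :: "nat \<Rightarrow> (real^2 \<Rightarrow> complex) \<Rightarrow> (int \<Rightarrow> complex) \<Rightarrow> (int \<Rightarrow> complex)" where
  "Op_N N f \<psi> = (\<lambda>y. \<Sum>\<^sub>\<infinity>n\<in>UNIV. fourier_coeff f n * T_N N n \<psi> y)"


section \<open>The quantum propagator\<close>

text \<open>
  Throughout, \<open>N\<close> is odd, matrices have determinant 1 modulo \<open>N\<close>, and only their entries modulo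
  \<open>N\<close> matter.  The unitary representation \<open>U_N\<close> defined here is the Weil representation, normalised
  by the exact Egorov identity $U_N(B)^* T_N(n) U_N(B) = T_N(nB)$ (\<open>n\<close> a row vector) for integral
  matrices \<open>B\<close> of determinant 1 that are congruent to the identity modulo 2; every matrix of
  determinant 1 modulo \<open>N\<close> lifts to such a \<open>B\<close>.  On the usual generators it is given by
  \<^item> $U_N(1, b; 0, 1)\psi(x) = e_N(2^{-1} b x^2)\psi(x)$,
  \<^item> $U_N(t, 0; 0, t^{-1})\psi(x) = (t/N)\psi(tx)$ with the Jacobi symbol $(t/N)$,
  \<^item> $U_N(0, 1; -1, 0)\psi(x) = G^{-1} \sum_y e_N(xy)\psi(y)$ with the Gauss sum
    $G = \sum_z e_N(-2^{-1} z^2)$, which has modulus $N^{1/2}$.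

  A matrix $g = (a, b; c, d)$ with \<open>c\<close> invertible modulo \<open>N\<close> factors as
  $(1, a/c; 0, 1)(t, 0; 0, t^{-1})(0, 1; -1, 0)(1, d/c; 0, 1)$ with $t = -1/c$.  Composing
  the generators gives the kernel below; since \<open>c\<close> is invertible, the product of $(t/N)$ and $G^{-1}$
  is the inverse of $\sum_z e_N(2^{-1} c z^2)$.
\<close>

definition weil_big_cell :: "nat \<Rightarrow> int^2^2 \<Rightarrow> (int \<Rightarrow> complex) \<Rightarrow> (int \<Rightarrow> complex)" where
  "weil_big_cell N g \<psi> = (\<lambda>x.
     (let a = g $ 1 $ 1; c = g $ 2 $ 1; d = g $ 2 $ 2 in
       (\<Sum>y\<in>{0..<int N}.
          e_N N (modular_inverse (int N) (2 * c) * (a * x\<^sup>2 - 2 * x * y + d * y\<^sup>2)) * \<psi> y)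
       / (\<Sum>z\<in>{0..<int N}. e_N N (modular_inverse (int N) 2 * c * z\<^sup>2))))"

text \<open>
  Every $g = (a, b; c, d)$ of determinant 1 modulo \<open>N\<close> is a product $(g h^{-1}) h$ of two matrices
  with invertible lower left entry:  take $h = (0, 1; -1, -s)$ with $d - cs$ invertible modulo \<open>N\<close>,
  so that $g h^{-1} = (b - as, -a; d - cs, -c)$.  Such an \<open>s\<close> exists because \<open>c\<close>, \<open>d\<close>, \<open>N\<close> have no
  common factor; as the operators form a representation, its choice is irrelevant.
\<close>

definition U_N :: "nat \<Rightarrow> int^2^2 \<Rightarrow> (int \<Rightarrow> complex) \<Rightarrow> (int \<Rightarrow> complex)" where
  "U_N N g =
     (let a = g $ 1 $ 1; b = g $ 1 $ 2; c = g $ 2 $ 1; d = g $ 2 $ 2;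
          s = int (LEAST s. coprime (d - c * int s) (int N))
      in weil_big_cell N (vector [vector [b - a * s, - a], vector [d - c * s, - c]])
         \<circ> weil_big_cell N (vector [vector [0, 1], vector [- 1, - s]]))"


section \<open>Hecke eigenfunctions\<close>

definition eigenfunction :: "((int \<Rightarrow> complex) \<Rightarrow> (int \<Rightarrow> complex)) \<Rightarrow> (int \<Rightarrow> complex) \<Rightarrow> bool" where
  "eigenfunction L \<psi> \<longleftrightarrow> (\<exists>y. \<psi> y \<noteq> 0) \<and> (\<exists>\<mu>. \<forall>y. L \<psi> y = \<mu> * \<psi> y)"

definition hecke_eigenfunction :: "int^2^2 \<Rightarrow> real \<Rightarrow> nat \<Rightarrow> (int \<Rightarrow> complex) \<Rightarrow> bool" where
  "hecke_eigenfunction A \<alpha> N \<psi> \<longleftrightarrow>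
     \<psi> \<in> hilbert N \<and> eigenfunction (U_N N A) \<psi> \<and>
     (\<forall>(n, m)\<in>norm_kernel A \<alpha> N. eigenfunction (U_N N (iota A n m)) \<psi>)"

end

theory Submission
  imports Defs
begin

text \<open>
  Take \<open>N = p\<^sup>3\<close> for a large prime \<open>p\<close> that splits in \<open>\<int>[\<alpha>]\<close>, so that \<open>A\<close> is diagonalizable modulo \<open>N\<close>,
  \<open>A = g diag(\<lambda>, 1/\<lambda>) g\<^sup>-\<^sup>1\<close>.  Every character \<open>\<phi>\<close> of \<open>(\<int>/N)\<^sup>*\<close> is an eigenfunction of the diagonal torus, and
  \<open>\<psi> = U(g) \<phi>\<close>, a quadratic-phase transform of \<open>\<phi>\<close>, is a Hecke eigenfunction.  For the observable
  \<open>e(x\<^sub>2)\<close> its matrix element is, up to normalization, the exponential sum of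
  \<open>e(- 2 \<gamma> y / N) \<phi>(y) \<phi>(y + 1)\<^sup>*\<close>.  Writing \<open>\<phi>\<close> on \<open>1 + p\<int>\<close> through a \<open>p\<close>-adic logarithm, the phase
  has critical points modulo \<open>p\<close> at the roots of a quadratic, and \<open>\<phi>\<close> can be chosen such that they coincide
  at \<open>y = -1/2\<close>.  There the phase is odd around the critical point, so that its quadratic term
  vanishes as well, while its cubic term is divisible by \<open>p\<^sup>3\<close>:  all \<open>p\<^sup>2\<close> residues near \<open>-1/2\<close> contribute
  coherently, and all others cancel.  The matrix element therefore has size about
  \<open>p\<^sup>2 / p\<^sup>3 = N\<close> to the power \<open>- 1/3\<close>.
\<close>

section \<open>Additive characters modulo \<open>N\<close>\<close>

lemma e_N_add: "e_N N (x + y) = e_N N x * e_N N y"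
  by (simp add: e_N_def cis_mult distrib_left add_divide_distrib)

lemma e_N_0 [simp]: "e_N N 0 = 1"
  by (simp add: e_N_def)

lemma cnj_e_N: "cnj (e_N N x) = e_N N (- x)"
  by (simp add: e_N_def cis_cnj)

lemma norm_e_N [simp]: "cmod (e_N N x) = 1"
  by (simp add: e_N_def)

lemma e_N_eq_1_iff:
  assumes "N > 0"
  shows "e_N N x = 1 \<longleftrightarrow> int N dvd x"
proof -
  have "e_N N x = 1 \<longleftrightarrow> (\<exists>k::int. 2 * pi * of_int x / of_nat N = of_int (2 * k) * pi)"
    by (simp add: e_N_def cis_conv_exp exp_eq_1)
  also have "\<dots> \<longleftrightarrow> (\<exists>k::int. real_of_int x = real_of_int (k * int N))"
    using assms by (auto simp: field_simps)
  also have "\<dots> \<longleftrightarrow> int N dvd x"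
    by (subst of_int_eq_iff) (auto simp: dvd_def mult.commute)
  finally show ?thesis .
qed

lemma e_N_cong:
  assumes "N > 0" "[x = y] (mod int N)"
  shows "e_N N x = e_N N y"
proof -
  have "e_N N (x - y) = 1"
    using assms by (simp add: e_N_eq_1_iff cong_iff_dvd_diff)
  then show ?thesis
    using e_N_add[of N "x - y" y] by simp
qed

section \<open>Complete sums over residues\<close>

lemma sum_mod_reindex:
  fixes N :: int and F :: "int \<Rightarrow> complex"
  assumes "N > 0"
    and per: "\<And>x y. [x = y] (mod N) \<Longrightarrow> F x = F y"
    and inj: "\<And>x y. [g x = g y] (mod N) \<Longrightarrow> [x = y] (mod N)"
  shows "(\<Sum>y\<in>{0..<N}. F (g y)) = (\<Sum>y\<in>{0..<N}. F y)"
proof -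
  have inj': "inj_on (\<lambda>y. g y mod N) {0..<N}"
  proof (rule inj_onI)
    fix x y assume "x \<in> {0..<N}" "y \<in> {0..<N}" "g x mod N = g y mod N"
    then show "x = y"
      using inj[of x y] by (simp add: cong_def)
  qed
  have "(\<lambda>y. g y mod N) ` {0..<N} = {0..<N}"
    by (rule endo_inj_surj[OF _ _ inj']) (use assms(1) in auto)
  then have "bij_betw (\<lambda>y. g y mod N) {0..<N} {0..<N}"
    using inj' by (simp add: bij_betw_def)
  then have "(\<Sum>y\<in>{0..<N}. F (g y mod N)) = (\<Sum>y\<in>{0..<N}. F y)"
    by (rule sum.reindex_bij_betw)
  moreover have "F (g y mod N) = F (g y)" for y
    by (rule per) (simp add: cong_def)
  ultimately show ?thesis by simp
qed

lemma sum_mod_shift: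
  fixes N :: int and F :: "int \<Rightarrow> complex"
  assumes "N > 0" "\<And>x y. [x = y] (mod N) \<Longrightarrow> F x = F y"
  shows "(\<Sum>y\<in>{0..<N}. F (y + a)) = (\<Sum>y\<in>{0..<N}. F y)"
  by (rule sum_mod_reindex[OF assms]) (simp_all add: cong_add_rcancel)

lemma sum_mod_scale:
  fixes N :: int and F :: "int \<Rightarrow> complex"
  assumes "N > 0" "\<And>x y. [x = y] (mod N) \<Longrightarrow> F x = F y" "coprime u N"
  shows "(\<Sum>y\<in>{0..<N}. F (u * y)) = (\<Sum>y\<in>{0..<N}. F y)"
  by (rule sum_mod_reindex[OF assms(1,2)]) (use assms(3) in \<open>simp_all add: cong_mult_lcancel\<close>)

text \<open>Orthogonality of additive characters: a shift of the variable by 1 preserves the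
  complete sum but multiplies it by \<open>e_N N k\<close>, so the sum vanishes unless this factor
  is 1.\<close>

lemma sum_e_N:
  assumes "N > 0"
  shows "(\<Sum>y\<in>{0..<int N}. e_N N (k * y)) = (if int N dvd k then of_nat N else 0)"
proof (cases "int N dvd k")
  case True
  then have "e_N N (k * y) = 1" for y
    using assms by (simp add: e_N_eq_1_iff)
  then show ?thesis using True by simp
next
  case False
  have "(\<Sum>y\<in>{0..<int N}. e_N N (k * (y + 1))) = (\<Sum>y\<in>{0..<int N}. e_N N (k * y))"
    by (rule sum_mod_shift[where F = "\<lambda>y. e_N N (k * y)"])
       (use assms in \<open>auto intro!: e_N_cong cong_scalar_left\<close>)
  moreover have "(\<Sum>y\<in>{0..<int N}. e_N N (k * (y + 1))) = (\<Sum>y\<in>{0..<int N}. e_N N (k * y)) * e_N N k"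
    by (simp add: distrib_left e_N_add sum_distrib_right)
  moreover have "e_N N k \<noteq> 1"
    using False assms by (simp add: e_N_eq_1_iff)
  ultimately show ?thesis
    using False by simp
qed

text \<open>Here \<open>r\<close> is an inverse of \<open>4 * q\<close>, so the translation
  \<open>z + 2 * r * l\<close> absorbs the linear term at the cost of the constant
  \<open>r * l\<^sup>2\<close>. The remaining Gauss sum is left unevaluated.\<close>

lemma quadratic_sum_complete_square:
  assumes "N > 0" "[4 * q * r = 1] (mod int N)"
  shows "(\<Sum>z\<in>{0..<int N}. e_N N (q * z\<^sup>2 + l * z))
       = e_N N (- (r * l\<^sup>2)) * (\<Sum>z\<in>{0..<int N}. e_N N (q * z\<^sup>2))"
proof -
  have "(\<Sum>z\<in>{0..<int N}. e_N N (q * z\<^sup>2)) = (\<Sum>z\<in>{0..<int N}. e_N N (q * (z + 2 * r * l)\<^sup>2))"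
    by (rule sum_mod_shift[symmetric])
       (use assms in \<open>auto intro!: e_N_cong cong_scalar_left cong_pow\<close>)
  also have "\<dots> = (\<Sum>z\<in>{0..<int N}. e_N N (q * z\<^sup>2 + l * z) * e_N N (r * l\<^sup>2))"
  proof (rule sum.cong[OF refl])
    fix z
    have "q * (z + 2 * r * l)\<^sup>2 - (q * z\<^sup>2 + l * z + r * l\<^sup>2) = (4 * q * r - 1) * (l * z + r * l\<^sup>2)"
      by (simp add: power2_eq_square algebra_simps)
    then have "[q * (z + 2 * r * l)\<^sup>2 = q * z\<^sup>2 + l * z + r * l\<^sup>2] (mod int N)"
      using assms(2) by (simp add: cong_iff_dvd_diff)
    then show "e_N N (q * (z + 2 * r * l)\<^sup>2) = e_N N (q * z\<^sup>2 + l * z) * e_N N (r * l\<^sup>2)"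
      using e_N_cong[OF assms(1)] by (simp flip: e_N_add)
  qed
  also have "\<dots> = (\<Sum>z\<in>{0..<int N}. e_N N (q * z\<^sup>2 + l * z)) * e_N N (r * l\<^sup>2)"
    by (simp add: sum_distrib_right)
  finally have "e_N N (- (r * l\<^sup>2)) * (\<Sum>z\<in>{0..<int N}. e_N N (q * z\<^sup>2))
     = (\<Sum>z\<in>{0..<int N}. e_N N (q * z\<^sup>2 + l * z)) * (e_N N (r * l\<^sup>2) * e_N N (- (r * l\<^sup>2)))"
    by simp
  then show ?thesis
    by (simp flip: e_N_add)
qed

section \<open>The Weil representation on quadratic-phase transforms\<close>

text \<open>Up to a scalar, \<open>chirp N (a/2c) (-1/c) (d/2c)\<close> is the big-cell operator of \<open>(a, b; c, d)\<close>.\<close>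

definition chirp :: "nat \<Rightarrow> int \<Rightarrow> int \<Rightarrow> int \<Rightarrow> (int \<Rightarrow> complex) \<Rightarrow> int \<Rightarrow> complex" where
  "chirp N \<alpha> \<beta> \<gamma> \<phi> x = (\<Sum>y\<in>{0..<int N}. e_N N (\<alpha> * x\<^sup>2 + \<beta> * x * y + \<gamma> * y\<^sup>2) * \<phi> y)"

lemma chirp_cong:
  assumes "N > 0" "[\<alpha> = \<alpha>'] (mod int N)" "[\<beta> = \<beta>'] (mod int N)" "[\<gamma> = \<gamma>'] (mod int N)"
    "[x = x'] (mod int N)"
  shows "chirp N \<alpha> \<beta> \<gamma> \<phi> x = chirp N \<alpha>' \<beta>' \<gamma>' \<phi> x'"
  unfolding chirp_def
  by (rule sum.cong[OF refl], rule arg_cong2[where f = "(*)"], rule e_N_cong)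
     (use assms in \<open>auto intro!: cong_add cong_mult cong_pow\<close>)

text \<open>Composing two Gaussian kernels gives a Gaussian kernel. The intermediate variable has
  quadratic coefficient \<open>i * d + \<alpha>\<close>, and \<open>r\<close> is an inverse of four
  times this coefficient, as completing the square requires. The scalar is the quotient of two Gauss
  sums.\<close>

lemma weil_big_cell_chirp:
  fixes N :: nat and g :: "int^2^2"
  defines "i \<equiv> modular_inverse (int N) (2 * g $ 2 $ 1)"
  assumes "N > 0" "[4 * (i * g $ 2 $ 2 + \<alpha>) * r = 1] (mod int N)"
  shows "\<exists>k. weil_big_cell N g (chirp N \<alpha> \<beta> \<gamma> \<phi>)
    = (\<lambda>x. k * chirp N (i * g $ 1 $ 1 - 4 * r * i\<^sup>2) (4 * r * i * \<beta>) (\<gamma> - r * \<beta>\<^sup>2) \<phi> x)"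
proof -
  define a d where "a = g $ 1 $ 1" and "d = g $ 2 $ 2"
  define G where "G = (\<Sum>z\<in>{0..<int N}. e_N N (modular_inverse (int N) 2 * g $ 2 $ 1 * z\<^sup>2))"
  define S where "S = (\<Sum>z\<in>{0..<int N}. e_N N ((i * d + \<alpha>) * z\<^sup>2))"
  have "weil_big_cell N g (chirp N \<alpha> \<beta> \<gamma> \<phi>) x
     = S / G * chirp N (i * a - 4 * r * i\<^sup>2) (4 * r * i * \<beta>) (\<gamma> - r * \<beta>\<^sup>2) \<phi> x" for x
  proof -
    have "(\<Sum>z\<in>{0..<int N}. e_N N (i * (a * x\<^sup>2 - 2 * x * z + d * z\<^sup>2)) * chirp N \<alpha> \<beta> \<gamma> \<phi> z)
      = (\<Sum>y\<in>{0..<int N}. \<Sum>z\<in>{0..<int N}. e_N N (i * (a * x\<^sup>2 - 2 * x * z + d * z\<^sup>2)) *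
           (e_N N (\<alpha> * z\<^sup>2 + \<beta> * z * y + \<gamma> * y\<^sup>2) * \<phi> y))"
      unfolding chirp_def sum_distrib_left by (rule sum.swap)
    also have "\<dots> = (\<Sum>y\<in>{0..<int N}. S * (e_N N ((i * a - 4 * r * i\<^sup>2) * x\<^sup>2 + 4 * r * i * \<beta> * x * y
        + (\<gamma> - r * \<beta>\<^sup>2) * y\<^sup>2) * \<phi> y))"
    proof (rule sum.cong[OF refl])
      fix y
      \<comment> \<open>For fixed \<open>x\<close> and \<open>y\<close>, this is the coefficient of
        \<open>z\<close> in the combined phase.\<close>
      define l where "l = \<beta> * y - 2 * i * x"
      have "(\<Sum>z\<in>{0..<int N}. e_N N (i * (a * x\<^sup>2 - 2 * x * z + d * z\<^sup>2)) *
           (e_N N (\<alpha> * z\<^sup>2 + \<beta> * z * y + \<gamma> * y\<^sup>2) * \<phi> y))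
        = (\<Sum>z\<in>{0..<int N}. e_N N (i * a * x\<^sup>2 + \<gamma> * y\<^sup>2) * \<phi> y *
            e_N N ((i * d + \<alpha>) * z\<^sup>2 + l * z))"
      proof (rule sum.cong[OF refl])
        fix z
        have eq: "i * (a * x\<^sup>2 - 2 * x * z + d * z\<^sup>2) + (\<alpha> * z\<^sup>2 + \<beta> * z * y + \<gamma> * y\<^sup>2)
           = (i * a * x\<^sup>2 + \<gamma> * y\<^sup>2) + ((i * d + \<alpha>) * z\<^sup>2 + l * z)"
          by (simp add: l_def algebra_simps)
        have "e_N N (i * (a * x\<^sup>2 - 2 * x * z + d * z\<^sup>2)) * e_N N (\<alpha> * z\<^sup>2 + \<beta> * z * y + \<gamma> * y\<^sup>2)
           = e_N N (i * a * x\<^sup>2 + \<gamma> * y\<^sup>2) * e_N N ((i * d + \<alpha>) * z\<^sup>2 + l * z)"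
          by (simp only: e_N_add[symmetric] eq)
        then show "e_N N (i * (a * x\<^sup>2 - 2 * x * z + d * z\<^sup>2)) *
           (e_N N (\<alpha> * z\<^sup>2 + \<beta> * z * y + \<gamma> * y\<^sup>2) * \<phi> y)
          = e_N N (i * a * x\<^sup>2 + \<gamma> * y\<^sup>2) * \<phi> y * e_N N ((i * d + \<alpha>) * z\<^sup>2 + l * z)"
          by (simp only: mult_ac)
      qed
      also have "\<dots> = e_N N (i * a * x\<^sup>2 + \<gamma> * y\<^sup>2) * \<phi> y * (e_N N (- (r * l\<^sup>2)) * S)"
        using quadratic_sum_complete_square[OF assms(2), of "i * d + \<alpha>" r l] assms(3)
        by (simp add: S_def d_def flip: sum_distrib_left)
      also have "\<dots> = S * (e_N N ((i * a * x\<^sup>2 + \<gamma> * y\<^sup>2) + (- (r * l\<^sup>2))) * \<phi> y)"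
        by (simp only: e_N_add mult_ac)
      also have "(i * a * x\<^sup>2 + \<gamma> * y\<^sup>2) + (- (r * l\<^sup>2))
         = (i * a - 4 * r * i\<^sup>2) * x\<^sup>2 + 4 * r * i * \<beta> * x * y + (\<gamma> - r * \<beta>\<^sup>2) * y\<^sup>2"
        by (simp add: l_def power2_eq_square algebra_simps)
      finally show "(\<Sum>z\<in>{0..<int N}. e_N N (i * (a * x\<^sup>2 - 2 * x * z + d * z\<^sup>2)) *
           (e_N N (\<alpha> * z\<^sup>2 + \<beta> * z * y + \<gamma> * y\<^sup>2) * \<phi> y))
         = S * (e_N N ((i * a - 4 * r * i\<^sup>2) * x\<^sup>2 + 4 * r * i * \<beta> * x * y + (\<gamma> - r * \<beta>\<^sup>2) * y\<^sup>2) * \<phi> y)" .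
    qed
    also have "\<dots> = S * chirp N (i * a - 4 * r * i\<^sup>2) (4 * r * i * \<beta>) (\<gamma> - r * \<beta>\<^sup>2) \<phi> x"
      by (simp add: chirp_def sum_distrib_left)
    finally show ?thesis
      by (simp add: weil_big_cell_def Let_def a_def d_def G_def i_def)
  qed
  then show ?thesis
    unfolding a_def by (intro exI[of _ "S / G"] ext)
qed

lemma weil_big_cell_scale: "weil_big_cell N g (\<lambda>x. k * \<psi> x) = (\<lambda>x. k * weil_big_cell N g \<psi> x)"
  by (simp add: weil_big_cell_def Let_def fun_eq_iff mult.left_commute[of _ k] flip: sum_distrib_left)

lemma U_N_scale: "U_N N g (\<lambda>x. k * \<psi> x) = (\<lambda>x. k * U_N N g \<psi> x)"
  by (simp add: U_N_def Let_def weil_big_cell_scale)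

text \<open>
  The big-cell operators act on transforms with arbitrary coefficients by completing the square.
  The scalar \<open>k\<close> would require evaluating Gauss sums, but eigenfunctions do not see it.
  The hypotheses say that \<open>(\<tau>, 1)\<close> is an eigenvector of \<open>g\<close> for the eigenvalue \<open>u\<close>.
\<close>

lemma U_N_chirp:
  fixes N :: nat and g :: "int^2^2"
  defines "a \<equiv> g $ 1 $ 1" and "b \<equiv> g $ 1 $ 2" and "c \<equiv> g $ 2 $ 1" and "d \<equiv> g $ 2 $ 2"
  defines "s \<equiv> int (LEAST s. coprime (d - c * int s) (int N))"
  assumes N: "odd N"
    and e: "coprime (d - c * s) (int N)" and Q: "coprime (s + \<tau>) (int N)"
    and h: "[2 * h = 1] (mod int N)"
    and u: "[c * \<tau> + d = u] (mod int N)" and ut: "[a * \<tau> + b = u * \<tau>] (mod int N)"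
    and v: "[a - c * \<tau> = v] (mod int N)" and uv: "[u * v = 1] (mod int N)"
    and \<gamma>: "[\<gamma> * (u - v) = h * c] (mod int N)"
  shows "\<exists>k. U_N N g (chirp N (h * \<tau>) 1 \<gamma> \<phi>)
    = (\<lambda>x. k * chirp N (h * \<tau>) v (\<gamma> * v\<^sup>2) \<phi> x)"
proof -
  define n where "n = int N"
  have N0: "N > 0" using N by (auto intro: Nat.gr0I)
  have cop2: "coprime 2 n" using N by (simp add: n_def)
  define e' where "e' = d - c * s"
  define Q' where "Q' = s + \<tau>"
  define i1 where "i1 = modular_inverse n (2 * - 1)"
  define i2 where "i2 = modular_inverse n (2 * e')"
  define r1 where "r1 = modular_inverse n (2 * Q')"
  \<comment> \<open>Modulo \<open>N\<close>, \<open>i2\<close> is 1/(2e') and \<open>r1\<close> is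
    1/(2Q'). Hence 4(- c i2 - r1) = -2(cQ' + e')/(e'Q') = -2u/(e'Q'), because cQ' + e' = c\<tau> +
    d. This gives \<open>r2\<close> as its inverse.\<close>
  define r2 where "r2 = - (h * e' * Q' * v)"
  \<comment> \<open>Each hypothesis and each defining property of an inverse becomes an integer
    divisible by \<open>n\<close>. Every congruence below then follows by writing the difference of
    its sides as an explicit integer combination of these residuals.\<close>
  define R1 Ri R2 Rr Ru Rt Rv Ruv Rg where "R1 = 2 * h - 1" and "Ri = 2 * - 1 * i1 - 1"
    and "R2 = 2 * e' * i2 - 1" and "Rr = 2 * Q' * r1 - 1" and "Ru = c * \<tau> + d - u"
    and "Rt = a * \<tau> + b - u * \<tau>" and "Rv = a - c * \<tau> - v" and "Ruv = u * v - 1"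
    and "Rg = \<gamma> * (u - v) - h * c"
  note R_defs = R1_def Ri_def R2_def Rr_def Ru_def Rt_def Rv_def Ruv_def Rg_def
  have R: "n dvd R1" "n dvd Ru" "n dvd Rt" "n dvd Rv" "n dvd Ruv" "n dvd Rg"
    using h u ut v uv \<gamma> by (simp_all add: R_defs cong_iff_dvd_diff n_def)
  have Ri: "n dvd Ri"
    using cong_modular_inverse1[of "2 * - 1" n] cop2 by (simp add: Ri_def i1_def cong_iff_dvd_diff)
  have R2: "n dvd R2"
    using cong_modular_inverse1[of "2 * e'" n] cop2 e
    unfolding R2_def i2_def cong_iff_dvd_diff coprime_mult_left_iff e'_def n_def by blast
  have Rr: "n dvd Rr"
    using cong_modular_inverse1[of "2 * Q'" n] cop2 Q
    unfolding Rr_def r1_def cong_iff_dvd_diff coprime_mult_left_iff Q'_def n_def by blast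
  note R = R Ri R2 Rr

  have "[4 * (i1 * (- s) + h * \<tau>) * r1 = 1] (mod n)"
  proof -
    have "4 * (i1 * (- s) + h * \<tau>) * r1 - 1 = 1 * Rr + 2 * s * r1 * Ri + 2 * \<tau> * r1 * R1"
      by (simp add: R_defs Q'_def algebra_simps)
    then show ?thesis
      unfolding cong_iff_dvd_diff using R by (auto intro!: dvd_add dvd_mult)
  qed
  then obtain k1 where k1: "weil_big_cell N (vector [vector [0, 1], vector [- 1, - s]])
      (chirp N (h * \<tau>) 1 \<gamma> \<phi>)
    = (\<lambda>x. k1 * chirp N (i1 * 0 - 4 * r1 * i1\<^sup>2) (4 * r1 * i1 * 1) (\<gamma> - r1 * 1\<^sup>2) \<phi> x)"
    using weil_big_cell_chirp[OF N0, of "vector [vector [0, 1], vector [- 1, - s]]" "h * \<tau>" r1 1 \<gamma> \<phi>]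
    by (auto simp: i1_def n_def)
  \<comment> \<open>Since \<open>i1\<close> represents -1/2, the first factor produces the
    parameters -1/(2Q'), -1/Q' and \<gamma> - 1/(2Q').\<close>
  have c1: "chirp N (i1 * 0 - 4 * r1 * i1\<^sup>2) (4 * r1 * i1 * 1) (\<gamma> - r1 * 1\<^sup>2) \<phi>
    = chirp N (- r1) (- 2 * r1) (\<gamma> - r1) \<phi>"
  proof (rule ext, rule chirp_cong[OF N0])
    have "(i1 * 0 - 4 * r1 * i1\<^sup>2) - (- r1) = (- r1 * (Ri + 2)) * Ri"
      by (simp add: R_defs power2_eq_square algebra_simps)
    then show "[i1 * 0 - 4 * r1 * i1\<^sup>2 = - r1] (mod int N)"
      unfolding cong_iff_dvd_diff using R by (metis dvd_mult n_def)
    have "4 * r1 * i1 * 1 - (- 2 * r1) = (- 2 * r1) * Ri"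
      by (simp add: R_defs algebra_simps)
    then show "[4 * r1 * i1 * 1 = - 2 * r1] (mod int N)"
      unfolding cong_iff_dvd_diff using R by (metis dvd_mult n_def)
  qed simp_all

  have "[4 * (i2 * (- c) + (- r1)) * r2 = 1] (mod n)"
  proof -
    have "4 * (i2 * (- c) + (- r1)) * r2 - 1
       = 2 * (i2 * c + r1) * e' * Q' * v * R1 + c * Q' * v * R2 + e' * v * Rr + v * Ru + 1 * Ruv"
      by (simp add: R_defs r2_def Q'_def e'_def algebra_simps)
    then show ?thesis
      unfolding cong_iff_dvd_diff using R by (auto intro!: dvd_add dvd_mult)
  qed
  then obtain k2 where k2: "weil_big_cell N (vector [vector [b - a * s, - a], vector [d - c * s, - c]])
      (chirp N (- r1) (- 2 * r1) (\<gamma> - r1) \<phi>)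
    = (\<lambda>x. k2 * chirp N (i2 * (b - a * s) - 4 * r2 * i2\<^sup>2) (4 * r2 * i2 * (- 2 * r1))
         (\<gamma> - r1 - r2 * (- 2 * r1)\<^sup>2) \<phi> x)"
    using weil_big_cell_chirp[OF N0, of "vector [vector [b - a * s, - a], vector [d - c * s, - c]]"
        "- r1" r2 "- 2 * r1" "\<gamma> - r1" \<phi>]
    by (auto simp: i2_def e'_def n_def)
  \<comment> \<open>The eigenvector equations bring the first parameter back to
    \<open>h * \<tau>\<close>. In the last one, 1 - e'v = v(u - e') = vcQ' leaves \<gamma> - vc/2,
    and the hypothesis on \<open>\<gamma>\<close> says exactly that this is \<gamma> v^2.\<close>
  have c2: "chirp N (i2 * (b - a * s) - 4 * r2 * i2\<^sup>2) (4 * r2 * i2 * (- 2 * r1))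
         (\<gamma> - r1 - r2 * (- 2 * r1)\<^sup>2) \<phi> = chirp N (h * \<tau>) v (\<gamma> * v\<^sup>2) \<phi>"
  proof (rule ext, rule chirp_cong[OF N0])
    have "(i2 * (b - a * s) - 4 * r2 * i2\<^sup>2) - h * \<tau>
       = (Q' * v * i2 * (1 + R2)) * R1 + Q' * v * i2 * R2
         + i2 * Rt + (- i2 * \<tau>) * Ru + (- i2 * Q') * Rv + (- i2 * e' * \<tau>) * R1 + (h * \<tau>) * R2"
      by (simp add: R_defs r2_def Q'_def e'_def power2_eq_square algebra_simps)
    also have "n dvd \<dots>"
      using R by (auto intro!: dvd_add dvd_mult)
    finally show "[i2 * (b - a * s) - 4 * r2 * i2\<^sup>2 = h * \<tau>] (mod int N)"
      by (simp add: cong_iff_dvd_diff n_def)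
    have "4 * r2 * i2 * (- 2 * r1) - v
       = (v * (1 + R2) * (1 + Rr)) * R1 + (v * (1 + Rr)) * R2 + v * Rr"
      by (simp add: R_defs r2_def algebra_simps)
    also have "n dvd \<dots>"
      using R by (auto intro!: dvd_add dvd_mult)
    finally show "[4 * r2 * i2 * (- 2 * r1) = v] (mod int N)"
      by (simp add: cong_iff_dvd_diff n_def)
    have "(\<gamma> - r1 - r2 * (- 2 * r1)\<^sup>2) - \<gamma> * v\<^sup>2
       = (r1 * e' * v * (1 + Rr)) * R1 + (r1 * e' * v) * Rr + (- \<gamma>) * Ruv + v * Rg
         + (r1 * v) * Ru + r1 * Ruv + (- c * v * h) * Rr + (c * v * r1 * Q') * R1"
      by (simp add: R_defs r2_def Q'_def e'_def power2_eq_square algebra_simps)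
    also have "n dvd \<dots>"
      using R by (auto intro!: dvd_add dvd_mult)
    finally show "[\<gamma> - r1 - r2 * (- 2 * r1)\<^sup>2 = \<gamma> * v\<^sup>2] (mod int N)"
      by (simp add: cong_iff_dvd_diff n_def)
  qed simp_all

  have "U_N N g (chirp N (h * \<tau>) 1 \<gamma> \<phi>) = (\<lambda>x. k1 * (k2 * chirp N (h * \<tau>) v (\<gamma> * v\<^sup>2) \<phi> x))"
    unfolding U_N_def Let_def a_def[symmetric] b_def[symmetric] c_def[symmetric] d_def[symmetric]
      s_def[symmetric] o_apply k1 c1 weil_big_cell_scale k2 c2 ..
  then show ?thesis
    by (intro exI[of _ "k1 * k2"]) (simp add: mult.assoc)
qed

section \<open>Multiplicative coefficients: eigenvalues and correlations\<close>

text \<open>The substitution of \<open>v * y\<close> for \<open>y\<close> turns the parameters 1 and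
  \<gamma> into \<open>v\<close> and \<open>\<gamma> * v\<^sup>2\<close>, and multiplicativity
  extracts \<open>\<phi> v\<close>, whose inverse is \<open>\<phi> u\<close>. Together with
  \<open>U_N_chirp\<close>, this makes the transform an eigenfunction.\<close>

lemma chirp_multiplicative:
  assumes N: "N > 0" and per: "\<And>x y. [x = y] (mod int N) \<Longrightarrow> \<phi> x = \<phi> y"
    and mult: "\<And>x y. \<phi> (x * y) = \<phi> x * \<phi> y" and one: "\<phi> 1 = 1"
    and uv: "[u * v = 1] (mod int N)"
  shows "chirp N \<alpha> v (\<gamma> * v\<^sup>2) \<phi> x = \<phi> u * chirp N \<alpha> 1 \<gamma> \<phi> x"
proof -
  define F where "F y = e_N N (\<alpha> * x\<^sup>2 + 1 * x * y + \<gamma> * y\<^sup>2) * \<phi> y" for y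
  have "coprime v (int N)"
    using uv by (metis coprime_iff_invertible_int mult.commute)
  then have "chirp N \<alpha> 1 \<gamma> \<phi> x = (\<Sum>y\<in>{0..<int N}. F (v * y))"
    unfolding chirp_def F_def
    by (intro sum_mod_scale[symmetric, where F = F, unfolded F_def] arg_cong2[where f = "(*)"] e_N_cong[OF N] per)
       (use N in \<open>auto intro!: cong_add cong_mult cong_pow\<close>)
  also have "\<dots> = \<phi> v * chirp N \<alpha> v (\<gamma> * v\<^sup>2) \<phi> x"
    by (simp add: F_def chirp_def mult sum_distrib_left power_mult_distrib mult_ac)
  finally have "\<phi> u * chirp N \<alpha> 1 \<gamma> \<phi> x = (\<phi> u * \<phi> v) * chirp N \<alpha> v (\<gamma> * v\<^sup>2) \<phi> x"
    by simp
  also have "\<phi> u * \<phi> v = 1"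
    using per[OF uv] mult one by simp
  finally show ?thesis by simp
qed

text \<open>Expanding both transforms leaves a linear character in \<open>x\<close>, since the
  phases \<alpha> x^2 cancel. Summing over \<open>x\<close> forces the second summation variable to
  be \<open>y + k\<close> modulo \<open>N\<close>. The case k = 0 computes the norm, and k = 1 the
  matrix element of the observable.\<close>

lemma chirp_correlation:
  assumes N: "N > 0" and per: "\<And>x y. [x = y] (mod int N) \<Longrightarrow> \<phi> x = \<phi> y"
  shows "(\<Sum>x\<in>{0..<int N}. e_N N (k * x) * (chirp N \<alpha> 1 \<gamma> \<phi> x * cnj (chirp N \<alpha> 1 \<gamma> \<phi> x)))
    = of_nat N * (\<Sum>y\<in>{0..<int N}. e_N N (\<gamma> * (y\<^sup>2 - (y + k)\<^sup>2)) * (\<phi> y * cnj (\<phi> (y + k))))"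
proof -
  define H where "H y z = e_N N (\<gamma> * (y\<^sup>2 - z\<^sup>2)) * (\<phi> y * cnj (\<phi> z))" for y z
  define D where "D y z = (if int N dvd k + y - z then of_nat N else (0::complex))" for y z
  have "(\<Sum>x\<in>{0..<int N}. e_N N (k * x) * (chirp N \<alpha> 1 \<gamma> \<phi> x * cnj (chirp N \<alpha> 1 \<gamma> \<phi> x)))
    = (\<Sum>x\<in>{0..<int N}. \<Sum>y\<in>{0..<int N}. \<Sum>z\<in>{0..<int N}. e_N N ((k + y - z) * x) * H y z)"
  proof (rule sum.cong[OF refl])
    fix x
    have "e_N N (k * x) * (chirp N \<alpha> 1 \<gamma> \<phi> x * cnj (chirp N \<alpha> 1 \<gamma> \<phi> x))
      = (\<Sum>y\<in>{0..<int N}. \<Sum>z\<in>{0..<int N}. e_N N (k * x) *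
          ((e_N N (\<alpha> * x\<^sup>2 + 1 * x * y + \<gamma> * y\<^sup>2) * \<phi> y) *
           (e_N N (- (\<alpha> * x\<^sup>2 + 1 * x * z + \<gamma> * z\<^sup>2)) * cnj (\<phi> z))))"
      by (simp only: chirp_def cnj_sum sum_product complex_cnj_mult cnj_e_N) (simp only: sum_distrib_left)
    also have "\<dots> = (\<Sum>y\<in>{0..<int N}. \<Sum>z\<in>{0..<int N}. e_N N ((k + y - z) * x) * H y z)"
    proof (intro sum.cong refl)
      fix y z
      have "k * x + ((\<alpha> * x\<^sup>2 + 1 * x * y + \<gamma> * y\<^sup>2) + - (\<alpha> * x\<^sup>2 + 1 * x * z + \<gamma> * z\<^sup>2))
         = (k + y - z) * x + \<gamma> * (y\<^sup>2 - z\<^sup>2)"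
        by (simp add: algebra_simps)
      then have "e_N N (k * x) * (e_N N (\<alpha> * x\<^sup>2 + 1 * x * y + \<gamma> * y\<^sup>2) *
          e_N N (- (\<alpha> * x\<^sup>2 + 1 * x * z + \<gamma> * z\<^sup>2)))
        = e_N N ((k + y - z) * x) * e_N N (\<gamma> * (y\<^sup>2 - z\<^sup>2))"
        by (simp only: e_N_add[symmetric])
      then show "e_N N (k * x) *
          ((e_N N (\<alpha> * x\<^sup>2 + 1 * x * y + \<gamma> * y\<^sup>2) * \<phi> y) *
           (e_N N (- (\<alpha> * x\<^sup>2 + 1 * x * z + \<gamma> * z\<^sup>2)) * cnj (\<phi> z)))
         = e_N N ((k + y - z) * x) * H y z"
        by (simp add: H_def mult_ac)
    qed
    finally show "e_N N (k * x) * (chirp N \<alpha> 1 \<gamma> \<phi> x * cnj (chirp N \<alpha> 1 \<gamma> \<phi> x))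
      = (\<Sum>y\<in>{0..<int N}. \<Sum>z\<in>{0..<int N}. e_N N ((k + y - z) * x) * H y z)" .
  qed
  also have "\<dots> = (\<Sum>y\<in>{0..<int N}. \<Sum>z\<in>{0..<int N}. \<Sum>x\<in>{0..<int N}. e_N N ((k + y - z) * x) * H y z)"
    by (subst sum.swap, rule sum.cong[OF refl], subst sum.swap, rule refl)
  also have "\<dots> = (\<Sum>y\<in>{0..<int N}. \<Sum>z\<in>{0..<int N}. D y z * H y z)"
    by (simp add: sum_e_N[OF N] D_def flip: sum_distrib_right)
  also have "\<dots> = (\<Sum>y\<in>{0..<int N}. of_nat N * H y (y + k))"
  proof (rule sum.cong[OF refl])
    fix y
    have "D y z * H y z = D y z' * H y z'" if "[z = z'] (mod int N)" for z z'
    proof -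
      have "D y z = D y z'"
        unfolding D_def using that by (metis cong_diff cong_dvd_iff cong_refl)
      moreover have "H y z = H y z'"
        unfolding H_def using per[OF that] that
        by (metis e_N_cong[OF N] cong_diff cong_pow cong_refl cong_scalar_left)
      ultimately show ?thesis by simp
    qed
    then have "(\<Sum>z\<in>{0..<int N}. D y z * H y z)
        = (\<Sum>z\<in>{0..<int N}. D y (z + (y + k)) * H y (z + (y + k)))"
      by (intro sum_mod_shift[symmetric]) (use N in auto)
    also have "\<dots> = (\<Sum>z\<in>{0..<int N}. if z = 0 then of_nat N * H y (y + k) else 0)"
      by (rule sum.cong) (auto simp: D_def zdvd_not_zless)
    also have "\<dots> = of_nat N * H y (y + k)"
      using N by simp
    finally show "(\<Sum>z\<in>{0..<int N}. D y z * H y z) = of_nat N * H y (y + k)" .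
  qed
  finally show ?thesis
    by (simp add: H_def sum_distrib_left)
qed

section \<open>A character with a degenerate critical point\<close>

text \<open>
  On multiples of \<open>p\<close>, this is \<open>log(1 + w)\<close> modulo \<open>p\<^sup>3\<close> without the cubic term; it is still additive there,
  with \<open>(p\<^sup>3 + 1) div 2\<close> playing the role of \<open>1/2\<close>.
\<close>

definition trunc_log :: "nat \<Rightarrow> int \<Rightarrow> int" where
  "trunc_log p w = w - (int p ^ 3 + 1) div 2 * w\<^sup>2"

text \<open>The power \<open>p - 1\<close> moves every unit into 1 + p\<int>, where the truncated
  logarithm is additive, and removes the part of the unit of order prime to \<open>p\<close>. The
  parameter \<open>K\<close> selects the frequency. Extension by 0 makes the function multiplicative
  on all integers.\<close>

definition log_char :: "nat \<Rightarrow> int \<Rightarrow> int \<Rightarrow> complex" where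
  "log_char p K y = (if int p dvd y then 0 else e_N (p ^ 3) (K * trunc_log p (y ^ (p - 1) - 1)))"

section \<open>Units modulo p^3 and the truncated logarithm\<close>

lemma coprime_prime_cube_iff:
  assumes "prime p"
  shows "coprime y (int (p ^ 3)) \<longleftrightarrow> \<not> int p dvd y"
proof -
  have "coprime y (int p) \<longleftrightarrow> \<not> int p dvd y"
    using assms
    by (metis coprime_common_divisor coprime_commute dvd_refl not_prime_unit prime_imp_coprime
        prime_nat_int_transfer)
  then show ?thesis
    by simp
qed

lemma half_cong:
  assumes "odd N"
  shows "[2 * ((int N + 1) div 2) = 1] (mod int N)"
proof -
  obtain k where k: "N = 2 * k + 1"
    using assms by (rule oddE)
  have "(int N + 1) div 2 = int k + 1"
    unfolding k by simp
  then show ?thesis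
    by (simp add: k cong_iff_dvd_diff)
qed

text \<open>The term \<open>w * w'\<close> of the product cancels against the cross term of the
  square, because \<open>h\<close> is half of 1 modulo p^3. All other terms contain at least three
  factors divisible by \<open>p\<close>.\<close>

lemma trunc_log_mult:
  assumes "odd p" "int p dvd w" "int p dvd w'"
  shows "[trunc_log p ((1 + w) * (1 + w') - 1) = trunc_log p w + trunc_log p w'] (mod int p ^ 3)"
proof -
  define h where "h = (int p ^ 3 + 1) div 2"
  from assms obtain x x' where w: "w = int p * x" "w' = int p * x'" by (auto elim!: dvdE)
  have h: "int p ^ 3 dvd 2 * h - 1"
    using half_cong[of "p ^ 3"] assms(1) by (simp add: cong_iff_dvd_diff h_def)
  have "trunc_log p ((1 + w) * (1 + w') - 1) - (trunc_log p w + trunc_log p w')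
    = (- (w * w')) * (2 * h - 1) + (- h * (2 * x * x * x' + 2 * x * x' * x' + int p * (x * x')\<^sup>2)) * int p ^ 3"
    unfolding trunc_log_def h_def[symmetric] by (simp add: w power2_eq_square power3_eq_cube algebra_simps)
  then show ?thesis
    using h by (simp add: cong_iff_dvd_diff dvd_add del: mult_minus_left minus_mult_left)
qed

lemma trunc_log_power:
  assumes "odd p" "int p dvd w"
  shows "int p dvd (1 + w) ^ n - 1 \<and> [trunc_log p ((1 + w) ^ n - 1) = int n * trunc_log p w] (mod int p ^ 3)"
proof (induction n)
  case 0
  then show ?case by (simp add: trunc_log_def)
next
  case (Suc n)
  have eq: "(1 + w) ^ Suc n - 1 = w * (1 + w) ^ n + ((1 + w) ^ n - 1)"
    by (simp add: algebra_simps)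
  have "int p dvd (1 + w) ^ Suc n - 1"
    unfolding eq using Suc.IH assms(2) by (intro dvd_add) auto
  moreover have "[trunc_log p ((1 + w) * (1 + ((1 + w) ^ n - 1)) - 1)
      = trunc_log p w + trunc_log p ((1 + w) ^ n - 1)] (mod int p ^ 3)"
    using trunc_log_mult assms Suc.IH by blast
  moreover have "[trunc_log p w + trunc_log p ((1 + w) ^ n - 1) = trunc_log p w + int n * trunc_log p w] (mod int p ^ 3)"
    using Suc.IH by (intro cong_add) auto
  ultimately have "[trunc_log p ((1 + w) * (1 + ((1 + w) ^ n - 1)) - 1) = trunc_log p w + int n * trunc_log p w] (mod int p ^ 3)"
    by (blast intro: cong_trans)
  moreover have "(1 + w) * (1 + ((1 + w) ^ n - 1)) - 1 = (1 + w) ^ Suc n - 1"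
    "trunc_log p w + int n * trunc_log p w = int (Suc n) * trunc_log p w"
    by (simp_all add: algebra_simps)
  ultimately show ?case
    using \<open>int p dvd (1 + w) ^ Suc n - 1\<close> by metis
qed

lemma trunc_log_cong:
  assumes "[w = w'] (mod n)"
  shows "[trunc_log p w = trunc_log p w'] (mod n)"
  unfolding trunc_log_def using assms by (intro cong_diff cong_scalar_left cong_pow)

lemma fermat_int:
  assumes "prime p" "\<not> int p dvd y"
  shows "int p dvd y ^ (p - 1) - 1"
proof -
  have "coprime y (int p)"
    using assms by (metis coprime_commute prime_imp_coprime prime_nat_int_transfer)
  then have "[y ^ totient p = 1] (mod int p)"
    using residues.euler_theorem[of "int p" y] prime_gt_1_nat[OF assms(1)]
    by (simp add: residues_def)
  then show ?thesis
    using totient_prime[OF assms(1)] by (simp add: cong_iff_dvd_diff)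
qed

section \<open>The multiplicative character\<close>

lemma log_char_cong:
  assumes "prime p" "[x = y] (mod int (p ^ 3))"
  shows "log_char p K x = log_char p K y"
proof -
  have "[x = y] (mod int p)"
    using assms(2) by (rule cong_dvd_modulus) simp
  then have "int p dvd x \<longleftrightarrow> int p dvd y"
    by (rule cong_dvd_iff)
  moreover have "e_N (p ^ 3) (K * trunc_log p (x ^ (p - 1) - 1))
      = e_N (p ^ 3) (K * trunc_log p (y ^ (p - 1) - 1))"
    using assms prime_gt_0_nat[OF assms(1)]
    by (intro e_N_cong cong_scalar_left trunc_log_cong cong_diff cong_pow) auto
  ultimately show ?thesis
    by (simp add: log_char_def)
qed

lemma log_char_mult:
  assumes p: "prime p" "odd p"
  shows "log_char p K (x * y) = log_char p K x * log_char p K y"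
proof (cases "int p dvd x \<or> int p dvd y")
  case True
  then show ?thesis by (auto simp: log_char_def)
next
  case False
  then have xy: "\<not> int p dvd x * y"
    using p(1) by (simp add: prime_dvd_mult_iff)
  define w w' where "w = x ^ (p - 1) - 1" and "w' = y ^ (p - 1) - 1"
  have "(x * y) ^ (p - 1) - 1 = (1 + w) * (1 + w') - 1"
    by (simp add: w_def w'_def power_mult_distrib)
  moreover have "int p dvd w" "int p dvd w'"
    using False fermat_int[OF p(1)] by (auto simp: w_def w'_def)
  ultimately have "[trunc_log p ((x * y) ^ (p - 1) - 1) = trunc_log p w + trunc_log p w'] (mod int (p ^ 3))"
    using trunc_log_mult[OF p(2)] by simp
  then have "e_N (p ^ 3) (K * trunc_log p ((x * y) ^ (p - 1) - 1))
      = e_N (p ^ 3) (K * (trunc_log p w + trunc_log p w'))"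
    using prime_gt_0_nat[OF p(1)] by (intro e_N_cong cong_scalar_left) auto
  then show ?thesis
    using False xy by (simp add: log_char_def w_def w'_def distrib_left e_N_add)
qed

lemma log_char_1:
  assumes "prime p"
  shows "log_char p K 1 = 1"
  using prime_gt_1_nat[OF assms] by (simp add: log_char_def trunc_log_def)

text \<open>The exponent \<open>p - 1\<close> is even. This symmetry makes the phase of the
  correlation sum odd about -1/2.\<close>

lemma log_char_minus:
  assumes "prime p" "odd p"
  shows "log_char p K (- y) = log_char p K y"
  using assms by (simp add: log_char_def)

lemma norm_log_char: "cmod (log_char p K y) = (if int p dvd y then 0 else 1)"
  by (simp add: log_char_def)

text \<open>On 1 + p\<int>, the power \<open>p - 1\<close> in the definition only multiplies the
  truncated logarithm by \<open>p - 1\<close>, so the character is the exponential of a quadratic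
  polynomial in \<open>w\<close>.\<close>

lemma log_char_principal:
  assumes p: "prime p" "odd p" and w: "int p dvd w"
  shows "log_char p K (1 + w) = e_N (p ^ 3) (K * (int p - 1) * trunc_log p w)"
proof -
  have "\<not> int p dvd 1 + w"
    using w prime_gt_1_nat[OF p(1)] by (simp add: dvd_add_left_iff)
  moreover have "[trunc_log p ((1 + w) ^ (p - 1) - 1) = int (p - 1) * trunc_log p w] (mod int (p ^ 3))"
    using trunc_log_power[OF p(2) w] by simp
  then have "e_N (p ^ 3) (K * trunc_log p ((1 + w) ^ (p - 1) - 1))
      = e_N (p ^ 3) (K * (int (p - 1) * trunc_log p w))"
    using prime_gt_0_nat[OF p(1)] by (intro e_N_cong cong_scalar_left) auto
  ultimately show ?thesis
    using prime_gt_1_nat[OF p(1)] by (simp add: log_char_def of_nat_diff mult.assoc)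
qed

section \<open>Stationary phase at a double critical point\<close>

text \<open>With p = 2q + 1, the condition describes the single residue class of \<open>q\<close>
  modulo \<open>p\<close>, which represents -1/2.\<close>

lemma card_double_root:
  assumes "odd p"
  shows "card {y \<in> {0..<int p ^ 3}. int p dvd 2 * y + 1} = p\<^sup>2"
proof -
  obtain q where q: "p = 2 * q + 1" using assms by (rule oddE)
  have "{y \<in> {0..<int p ^ 3}. int p dvd 2 * y + 1} = (\<lambda>z. int q + int p * z) ` {0..<int p ^ 2}"
  proof (intro subset_antisym subsetI)
    fix y assume "y \<in> {y \<in> {0..<int p ^ 3}. int p dvd 2 * y + 1}"
    then have y: "0 \<le> y" "y < int p ^ 3" "int p dvd 2 * y + 1" by auto
    have "2 * y + 1 = 2 * (y - int q) + int p"
      by (simp add: q)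
    then have "int p dvd 2 * (y - int q)"
      using y(3) by (metis dvd_add_left_iff dvd_refl)
    moreover have "coprime (int p) 2"
      using assms by (simp add: coprime_commute)
    ultimately have "int p dvd y - int q"
      by (simp only: coprime_dvd_mult_right_iff)
    then obtain z where "y - int q = int p * z" ..
    then have z: "y = int q + int p * z" by simp
    have "0 \<le> z"
    proof (rule ccontr)
      assume "\<not> 0 \<le> z"
      then have "int p * z \<le> int p * (- 1)" by (intro mult_left_mono) auto
      then show False using y(1) z q by simp
    qed
    moreover have "int p * z < int p * int p ^ 2"
      using y(2) z by (simp add: power3_eq_cube power2_eq_square)
    then have "z < int p ^ 2"
      using q by (simp add: mult_less_cancel_left)
    ultimately show "y \<in> (\<lambda>z. int q + int p * z) ` {0..<int p ^ 2}"
      using z by auto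
  next
    fix y assume "y \<in> (\<lambda>z. int q + int p * z) ` {0..<int p ^ 2}"
    then obtain z where z: "0 \<le> z" "z < int p ^ 2" "y = int q + int p * z" by auto
    have "int p * z \<le> int p * (int p ^ 2 - 1)"
      using z(2) by (intro mult_left_mono) auto
    then have "y < int p ^ 3"
      using z(3) q by (simp add: power3_eq_cube power2_eq_square algebra_simps)
    moreover have "2 * y + 1 = int p * (2 * z + 1)"
      using z(3) q by (simp add: algebra_simps)
    ultimately show "y \<in> {y \<in> {0..<int p ^ 3}. int p dvd 2 * y + 1}"
      using z by auto
  qed
  moreover have "inj_on (\<lambda>z. int q + int p * z) {0..<int p ^ 2}"
    using q by (auto simp: inj_on_def)
  ultimately have "card {y \<in> {0..<int p ^ 3}. int p dvd 2 * y + 1} = card {0..<int p ^ 2}"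
    by (simp add: card_image)
  also have "\<dots> = p\<^sup>2"
    by (simp add: nat_power_eq)
  finally show ?thesis .
qed

text \<open>Stationary phase modulo p^3: along the translates of \<open>y\<close> by multiples of
  p^2 the phase is linear, so their contributions cancel unless its derivative vanishes modulo
  \<open>p\<close>. The condition on \<open>K\<close> makes this derivative a unit times (2y + 1)^2.
  On the class of -1/2 the summand is constant, and the p^2 residues there add up without
  cancellation.\<close>

lemma log_char_sum:
  assumes p: "prime p" "odd p" and \<theta>: "\<not> int p dvd \<theta>"
    and K: "[4 * K * (int p - 1) = - \<theta>] (mod int (p ^ 3))"
  shows "cmod (\<Sum>y\<in>{0..<int (p ^ 3)}. e_N (p ^ 3) (- \<theta> * y) * (log_char p K y * cnj (log_char p K (y + 1))))
    = (real p)\<^sup>2"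
proof -
  define N where "N = p ^ 3"
  define \<phi> where "\<phi> = log_char p K"
  define h where "h = (int N + 1) div 2"
  define H where "H y = e_N N (- \<theta> * y) * (\<phi> y * cnj (\<phi> (y + 1)))" for y
  have p0: "p > 0" "p > 1" using p(1) prime_gt_0_nat prime_gt_1_nat by auto
  have N0: "N > 0" using p0 by (simp add: N_def)
  have h: "int N dvd 2 * h - 1"
    using half_cong[of N] p(2) by (simp add: N_def h_def cong_iff_dvd_diff)
  have K': "int N dvd 4 * K * (int p - 1) + \<theta>"
    using K by (simp add: N_def cong_iff_dvd_diff)
  have phi_cong: "\<phi> x = \<phi> y" if "[x = y] (mod int N)" for x y
    unfolding \<phi>_def using log_char_cong[OF p(1)] that by (simp add: N_def)
  have H_cong: "H x = H y" if "[x = y] (mod int N)" for x y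
  proof -
    have "\<phi> (x + 1) = \<phi> (y + 1)" "\<phi> x = \<phi> y"
      using that by (auto intro!: phi_cong cong_add)
    moreover have "e_N N (- \<theta> * x) = e_N N (- \<theta> * y)"
      using that N0 by (intro e_N_cong cong_scalar_left)
    ultimately show ?thesis by (simp add: H_def)
  qed

  \<comment> \<open>With w = 2y + 1, the character contributes log(1 - w) - log(1 + w). The
    quadratic terms cancel, and the choice of \<open>K\<close> turns the linear terms into \<theta>
    w/2, which added to -\<theta> y leaves the constant \<theta>/2.\<close>
  have H_const: "H y = e_N N (h * \<theta>)" if y: "int p dvd 2 * y + 1" for y
  proof -
    define w where "w = 2 * y + 1"
    have p2: "\<not> int p dvd 2"
      using p p0 by (metis int_dvd_int_iff of_nat_numeral primes_dvd_imp_eq two_is_prime_nat even_numeral)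
    \<comment> \<open>The factor |\<phi>(2)|^2 is 1. It replaces \<open>y\<close> and
      \<open>y + 1\<close> by \<open>2 * y\<close> and \<open>2 * (y + 1)\<close>, which up to sign
      are 1 - w and 1 + w, both in 1 + p\<int>.\<close>
    have "\<phi> y * cnj (\<phi> (y + 1)) = (\<phi> 2 * cnj (\<phi> 2)) * (\<phi> y * cnj (\<phi> (y + 1)))"
      using p2 norm_log_char[of p K 2] by (simp add: \<phi>_def complex_norm_square[symmetric])
    also have "\<dots> = \<phi> (2 * y) * cnj (\<phi> (2 * (y + 1)))"
      unfolding \<phi>_def log_char_mult[OF p] by simp
    also have "\<phi> (2 * y) = \<phi> (1 + (- w))"
      unfolding \<phi>_def by (subst log_char_minus[OF p, symmetric]) (simp add: w_def)
    also have "\<dots> = e_N N (K * (int p - 1) * trunc_log p (- w))"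
      unfolding \<phi>_def N_def using y by (intro log_char_principal[OF p]) (simp only: w_def dvd_minus_iff)
    also have "2 * (y + 1) = 1 + w"
      by (simp add: w_def)
    also have "\<phi> (1 + w) = e_N N (K * (int p - 1) * trunc_log p w)"
      unfolding \<phi>_def N_def using y by (intro log_char_principal[OF p]) (simp only: w_def)
    finally have "H y = e_N N (- \<theta> * y + (K * (int p - 1) * trunc_log p (- w)
        + - (K * (int p - 1) * trunc_log p w)))"
      by (simp only: H_def e_N_add cnj_e_N)
    also have "\<dots> = e_N N (h * \<theta>)"
    proof (rule e_N_cong[OF N0])
      have "(- \<theta> * y + (K * (int p - 1) * trunc_log p (- w) + - (K * (int p - 1) * trunc_log p w))) - h * \<theta>
        = (- \<theta> * y - 2 * K * (int p - 1) * w) - h * \<theta>"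
        by (simp add: trunc_log_def algebra_simps)
      also have "\<dots> = (\<theta> * y + 2 * K * (int p - 1) * w) * (2 * h - 1)
          + (- h * w) * (4 * K * (int p - 1) + \<theta>)"
        by (simp add: w_def algebra_simps)
      also have "int N dvd \<dots>"
        by (rule dvd_add[OF dvd_mult[OF h] dvd_mult[OF K']])
      finally show "[- \<theta> * y + (K * (int p - 1) * trunc_log p (- w) + - (K * (int p - 1) * trunc_log p w))
         = h * \<theta>] (mod int N)"
        by (simp add: cong_iff_dvd_diff)
    qed
    finally show ?thesis .
  qed

  have H_sum: "(\<Sum>t\<in>{0..<int p}. H (y + int p ^ 2 * t))
      = (if int p dvd 2 * y + 1 then of_nat p * e_N N (h * \<theta>) else 0)" for y
  proof (cases "int p dvd 2 * y + 1")
    case True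
    have "H (y + int p ^ 2 * t) = e_N N (h * \<theta>)" for t
    proof (rule H_const)
      have "2 * (y + int p ^ 2 * t) + 1 = (2 * y + 1) + int p * (2 * int p * t)"
        by (simp add: power2_eq_square algebra_simps)
      then show "int p dvd 2 * (y + int p ^ 2 * t) + 1"
        using True by (simp only: dvd_add dvd_triv_left)
    qed
    then show ?thesis using True by simp
  next
    case not_crit: False
    have dvd_shift: "int p dvd z + int p ^ 2 * t \<longleftrightarrow> int p dvd z" for z t
      by (rule dvd_add_left_iff) (simp add: power2_eq_square)
    show ?thesis
    \<comment> \<open>If \<open>y\<close> is 0 or -1 modulo \<open>p\<close>, one factor of the
      summand vanishes on the whole orbit of translates. Otherwise \<open>y\<close> and
      \<open>y + 1\<close> are units.\<close>
    proof (cases "int p dvd y \<or> int p dvd y + 1")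
      case True
      have "H (y + int p ^ 2 * t) = 0" for t
        using True dvd_shift[of y t] dvd_shift[of "y + 1" t]
        by (auto simp: H_def \<phi>_def log_char_def algebra_simps)
      then show ?thesis using not_crit by simp
    next
      case False
      then have "coprime y (int N)" "coprime (y + 1) (int N)"
        unfolding N_def coprime_prime_cube_iff[OF p(1)] by auto
      then obtain y1 y2 where y1: "[y * y1 = 1] (mod int N)" and y2: "[(y + 1) * y2 = 1] (mod int N)"
        by (auto simp: coprime_iff_invertible_int)
      \<comment> \<open>Writing z + p^2 t as z(1 + p^2 t/z) reduces the shift to a principal unit.
        Its truncated logarithm is linear modulo p^3, because the square of p^2 is divisible by
        p^3.\<close>
      have shift: "\<phi> (z + int p ^ 2 * t) = \<phi> z * e_N N (K * (int p - 1) * (int p ^ 2 * t * z'))"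
        if z': "[z * z' = 1] (mod int N)" for z z' t
      proof -
        have "[z + int p ^ 2 * t * 1 = z + int p ^ 2 * t * (z * z')] (mod int N)"
          using z' by (intro cong_add cong_scalar_left) (auto simp: cong_sym)
        then have "\<phi> (z + int p ^ 2 * t) = \<phi> (z * (1 + int p ^ 2 * t * z'))"
          by (intro phi_cong) (simp add: algebra_simps)
        also have "\<dots> = \<phi> z * \<phi> (1 + int p ^ 2 * t * z')"
          unfolding \<phi>_def by (rule log_char_mult[OF p])
        also have "\<phi> (1 + int p ^ 2 * t * z') = e_N N (K * (int p - 1) * trunc_log p (int p ^ 2 * t * z'))"
          unfolding \<phi>_def N_def by (rule log_char_principal[OF p]) (simp add: power2_eq_square)
        also have "\<dots> = e_N N (K * (int p - 1) * (int p ^ 2 * t * z'))"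
        proof (rule e_N_cong[OF N0], rule cong_scalar_left)
          have "trunc_log p (int p ^ 2 * t * z') - int p ^ 2 * t * z'
              = - ((int p ^ 3 + 1) div 2 * (int p * (t * z')\<^sup>2)) * int N"
            by (simp add: trunc_log_def N_def power2_eq_square power3_eq_cube)
          then show "[trunc_log p (int p ^ 2 * t * z') = int p ^ 2 * t * z'] (mod int N)"
            by (simp add: cong_iff_dvd_diff)
        qed
        finally show ?thesis .
      qed
      \<comment> \<open>This is the derivative of the phase, with \<open>y1\<close> and
        \<open>y2\<close> standing for 1/y and 1/(y + 1).\<close>
      define w where "w = - \<theta> + K * (int p - 1) * (y1 - y2)"
      have H_shift: "H (y + int p ^ 2 * t) = H y * e_N N (int p ^ 2 * t * w)" for t
      proof -
        have "H (y + int p ^ 2 * t) = e_N N (- \<theta> * y + - \<theta> * (int p ^ 2 * t)) *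
            (\<phi> (y + int p ^ 2 * t) * cnj (\<phi> ((y + 1) + int p ^ 2 * t)))"
          by (simp add: H_def algebra_simps)
        also have "\<dots> = H y * (e_N N (- \<theta> * (int p ^ 2 * t)) * (e_N N (K * (int p - 1) * (int p ^ 2 * t * y1))
            * e_N N (- (K * (int p - 1) * (int p ^ 2 * t * y2)))))"
          by (simp only: shift[OF y1] shift[OF y2] H_def e_N_add complex_cnj_mult cnj_e_N)
             (simp only: mult_ac)
        also have "e_N N (- \<theta> * (int p ^ 2 * t)) * (e_N N (K * (int p - 1) * (int p ^ 2 * t * y1))
            * e_N N (- (K * (int p - 1) * (int p ^ 2 * t * y2)))) = e_N N (int p ^ 2 * t * w)"
          unfolding e_N_add[symmetric] by (rule arg_cong[where f = "e_N N"]) (simp add: w_def algebra_simps)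
        finally show ?thesis .
      qed
      have "\<not> int p dvd w"
      proof
        assume pw: "int p dvd w"
        have pN: "int p dvd int N" by (simp add: N_def)
        have y1': "int p dvd y * y1 - 1" and y2': "int p dvd (y + 1) * y2 - 1"
          and K'': "int p dvd 4 * K * (int p - 1) + \<theta>"
          using y1 y2 K' pN by (auto simp: cong_iff_dvd_diff intro: dvd_trans)
        \<comment> \<open>Clearing denominators in \<open>w\<close> and inserting 4K(p - 1) =
          -\<theta> gives -4y(y + 1)w = \<theta>(2y + 1)^2 modulo \<open>p\<close>: the quadratic
          for the critical points is a perfect square.\<close>
        have "\<theta> * (2 * y + 1)\<^sup>2 = (- 4 * y * (y + 1)) * w
            + (4 * K * (int p - 1) * (y + 1)) * (y * y1 - 1) + (- 4 * K * (int p - 1) * y) * ((y + 1) * y2 - 1)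
            + 1 * (4 * K * (int p - 1) + \<theta>)"
          by (simp add: w_def power2_eq_square algebra_simps)
        also have "int p dvd \<dots>"
          by (rule dvd_add[OF dvd_add[OF dvd_add[OF dvd_mult[OF pw] dvd_mult[OF y1']] dvd_mult[OF y2']] dvd_mult[OF K'']])
        finally show False
          using \<theta> not_crit p(1) by (simp add: prime_dvd_mult_iff power2_eq_square)
      qed
      have "(\<Sum>t\<in>{0..<int p}. e_N N (int p ^ 2 * t * w)) = (\<Sum>t\<in>{0..<int p}. e_N p (w * t))"
        using p0 by (intro sum.cong refl) (simp add: e_N_def N_def power2_eq_square power3_eq_cube field_simps)
      also have "\<dots> = 0"
        using \<open>\<not> int p dvd w\<close> p0 by (simp add: sum_e_N)
      finally show ?thesis
        using not_crit by (simp add: H_shift flip: sum_distrib_left)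
    qed
  qed

  \<comment> \<open>Each of the \<open>p\<close> translations leaves the complete sum unchanged, so
    \<open>p\<close> times the sum equals the sum of the orbit sums.\<close>
  have "of_nat p * (\<Sum>y\<in>{0..<int N}. H y) = (\<Sum>t\<in>{0..<int p}. \<Sum>y\<in>{0..<int N}. H (y + int p ^ 2 * t))"
    using sum_mod_shift[of "int N" H] H_cong N0 by simp
  also have "\<dots> = (\<Sum>y\<in>{0..<int N}. if int p dvd 2 * y + 1 then of_nat p * e_N N (h * \<theta>) else 0)"
    by (subst sum.swap) (simp add: H_sum)
  also have "\<dots> = (\<Sum>y\<in>{y \<in> {0..<int N}. int p dvd 2 * y + 1}. of_nat p * e_N N (h * \<theta>))"
    by (rule sum.inter_filter[symmetric]) simp
  also have "\<dots> = of_nat p * (of_nat (p\<^sup>2) * e_N N (h * \<theta>))"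
    using card_double_root[OF p(2)] by (simp add: N_def)
  finally have "(\<Sum>y\<in>{0..<int N}. H y) = of_nat (p\<^sup>2) * e_N N (h * \<theta>)"
    using p0 by simp
  then show ?thesis
    by (simp add: H_def \<phi>_def N_def norm_mult norm_power)
qed

section \<open>The observable\<close>

text \<open>A directional derivative of a multiple of the character is again a multiple of it, so
  the induction runs over all constants \<open>c\<close> at once.\<close>

lemma C_k_character: "C_k k (\<lambda>x::real^2. c * cis (2 * pi * x $ 2))"
proof (induction k arbitrary: c)
  case 0
  show ?case by (auto intro!: continuous_intros)
next
  case (Suc k)
  have deriv: "((\<lambda>x::real^2. c * cis (2 * pi * x $ 2)) has_derivative
      (\<lambda>v. (c * \<i> * of_real (2 * pi * v $ 2)) * cis (2 * pi * x $ 2))) (at x)" for x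
    by (auto intro!: derivative_eq_intros bounded_linear.has_derivative[OF bounded_linear_vec_nth]
        simp: scaleR_conv_of_real mult_ac)
  show ?case
  proof (unfold C_k.simps, intro conjI allI)
    show "(\<lambda>x::real^2. c * cis (2 * pi * x $ 2)) differentiable (at x)" for x
      using deriv differentiableI by blast
    have "frechet_derivative (\<lambda>x::real^2. c * cis (2 * pi * x $ 2)) (at x) v
        = (c * \<i> * of_real (2 * pi * v $ 2)) * cis (2 * pi * x $ 2)" for x v
      by (simp flip: frechet_derivative_at[OF deriv])
    then show "C_k k (\<lambda>x. frechet_derivative (\<lambda>x::real^2. c * cis (2 * pi * x $ 2)) (at x) v)" for v
      using Suc.IH by presburger
  qed
qed

lemma torus_smooth_character: "torus_smooth (\<lambda>x. cis (2 * pi * x $ 2))"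
proof -
  have "cis (2 * pi * (x + axis i 1) $ 2) = cis (2 * pi * x $ 2)" for x :: "real^2" and i
    by (cases "i = 2") (simp_all add: axis_def distrib_left flip: cis_mult)
  then show ?thesis
    using C_k_character[of _ 1] by (simp add: torus_smooth_def)
qed

section \<open>Fourier orthogonality on the torus\<close>

text \<open>Translation of the box by \<open>v\<close> in coordinate \<open>i\<close> preserves the
  integral by periodicity and negates it by antiperiodicity. The lemma \<open>split\<close> compares
  the two boxes along that coordinate.\<close>

lemma integral_unit_box_antiperiodic:
  fixes f :: "real^'n \<Rightarrow> complex"
  assumes cont: "continuous_on UNIV f"
    and per: "\<And>x. f (x + axis i 1) = f x"
    and anti: "\<And>x. f (x + axis i v) = - f x" and v: "0 < v" "v < 1"
  shows "integral (cbox 0 1) f = 0"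
proof -
  define B where "B s t = cbox (\<chi> j. if j = i then s else 0) (\<chi> j. if j = i then t else (1::real))" for s t
  define J where "J s t = integral (B s t) f" for s t
  have J: "(f has_integral J s t) (B s t)" for s t
    unfolding J_def B_def
    by (rule integrable_integral) (use cont in \<open>auto intro: integrable_continuous continuous_on_subset\<close>)
  have split: "J s u = J s t + J t u" if "s \<le> t" "t \<le> u" for s t u
  proof -
    have k: "axis i 1 \<in> (Basis :: (real^'n) set)"
      by simp
    have "B s u \<inter> {x. x \<bullet> axis i 1 \<le> t} = B s t" "B s u \<inter> {x. x \<bullet> axis i 1 \<ge> t} = B t u"
      using that by (auto simp: B_def mem_box_cart inner_axis) (smt (verit))+
    then have "(f has_integral (J s t + J t u)) (B s u)"
      using has_integral_split[OF _ _ k, of f "J s t" _ _ t "J t u"] J unfolding B_def by metis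
    then show ?thesis
      using J has_integral_unique by blast
  qed
  have shift: "J (s + r) (t + r) = integral (B s t) (\<lambda>x. f (x + axis i r))" for s t r
  proof -
    have "(\<chi> j. if j = i then s else c) + axis i r = (\<chi> j. if j = i then s + r else c)" for s c :: real
      by (simp add: vec_eq_iff axis_def)
    then show ?thesis
      using integral_shift_cbox_plus[of "\<chi> j. if j = i then s else 0" "\<chi> j. if j = i then t else 1" f "axis i r"]
      by (simp add: J_def B_def o_def add.commute[of "axis i r"])
  qed
  have "J 1 (1 + v) = J 0 v"
    using shift[of 0 1 v] by (simp add: per J_def add.commute)
  moreover have "J v (1 + v) = - J 0 1"
    using shift[of 0 v 1] by (simp add: anti J_def add.commute)
  ultimately have "J 0 1 = - J 0 1"
    using split[of 0 1 "1 + v"] split[of 0 v "1 + v"] v by simp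
  then have "J 0 1 = 0"
    by simp
  moreover have "B 0 1 = cbox 0 1"
    by (simp add: B_def zero_vec_def one_vec_def if_distrib cong: if_cong)
  ultimately show ?thesis
    by (simp add: J_def)
qed

lemma torus_integral_character:
  fixes k :: "int^2"
  assumes "k \<noteq> 0"
  shows "torus_integral (\<lambda>x. cis (2 * pi * ((\<chi> i. real_of_int (k $ i)) \<bullet> x))) = 0"
proof -
  obtain i where i: "k $ i \<noteq> 0"
    using assms by (auto simp: vec_eq_iff)
  define f where "f x = cis (2 * pi * ((\<chi> i. real_of_int (k $ i)) \<bullet> x))" for x :: "real^2"
  \<comment> \<open>Half a period of the character in coordinate \<open>i\<close>, hence at most
    1/2.\<close>
  define v where "v = 1 / (2 * real_of_int \<bar>k $ i\<bar>)"
  have f_add: "f (x + axis i r) = f x * cis (2 * pi * (real_of_int (k $ i) * r))" for x r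
    by (simp add: f_def inner_add_right inner_axis distrib_left flip: cis_mult)
  have "integral (cbox 0 1) f = 0"
  proof (rule integral_unit_box_antiperiodic)
    show "continuous_on UNIV f"
      unfolding f_def by (intro continuous_intros)
    show "f (x + axis i 1) = f x" for x
      by (simp add: f_add)
    have "cis (2 * pi * (real_of_int (k $ i) * v)) = - 1"
    proof (cases "k $ i > 0")
      case True
      then show ?thesis by (simp add: v_def)
    next
      case False
      then have "real_of_int (k $ i) * v = - (1 / 2)"
        using i by (simp add: v_def field_simps)
      then show ?thesis
        by (simp add: complex_eq_iff)
    qed
    then show "f (x + axis i v) = - f x" for x
      by (simp add: f_add)
    show "0 < v" "v < 1"
      using i by (auto simp: v_def field_simps)
  qed
  then show ?thesis
    by (simp add: torus_integral_def f_def[abs_def])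
qed

lemma torus_integral_character_2: "torus_integral (\<lambda>x. cis (2 * pi * x $ 2)) = 0"
proof -
  have "(\<chi> i. real_of_int (axis 2 1 $ i)) \<bullet> x = x $ 2" for x :: "real^2"
    by (simp add: inner_vec_def axis_def UNIV_2)
  then show ?thesis
    using torus_integral_character[of "axis 2 1"] by (simp add: axis_eq_0_iff)
qed

lemma fourier_coeff_character:
  "fourier_coeff (\<lambda>x. cis (2 * pi * x $ 2)) n = (if n = axis 2 1 then 1 else 0)"
proof -
  have "cis (2 * pi * x $ 2) * cis (- 2 * pi * ((\<chi> i. real_of_int (n $ i)) \<bullet> x))
      = cis (2 * pi * ((\<chi> i. real_of_int ((axis 2 1 - n) $ i)) \<bullet> x))" for x :: "real^2"
    by (simp add: cis_mult inner_vec_def axis_def UNIV_2 algebra_simps)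
  then have eq: "fourier_coeff (\<lambda>x. cis (2 * pi * x $ 2)) n
      = torus_integral (\<lambda>x. cis (2 * pi * ((\<chi> i. real_of_int ((axis 2 1 - n) $ i)) \<bullet> x)))"
    by (simp add: fourier_coeff_def)
  show ?thesis
  proof (cases "n = axis 2 1")
    case True
    have "Henstock_Kurzweil_Integration.content (cbox 0 (1::real^2)) = 1"
      by (simp add: content_cbox_if_cart interval_eq_empty_cart)
    then show ?thesis
      using True unfolding eq by (simp add: torus_integral_def inner_vec_def)
  next
    case False
    then show ?thesis
      unfolding eq using torus_integral_character[of "axis 2 1 - n"] by simp
  qed
qed

text \<open>Only the frequency (0, 1) survives, where \<open>T_N\<close> involves no translation and
  its factor at level \<open>2 * N\<close> is 1.\<close>

lemma Op_N_character: "Op_N N (\<lambda>x. cis (2 * pi * x $ 2)) \<psi> y = e_N N y * \<psi> y"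
proof -
  have "Op_N N (\<lambda>x. cis (2 * pi * x $ 2)) \<psi> y
    = (\<Sum>\<^sub>\<infinity>n\<in>UNIV. (if n = axis 2 1 then 1 else 0) * T_N N n \<psi> y)"
    by (simp add: Op_N_def fourier_coeff_character)
  also have "\<dots> = (\<Sum>\<^sub>\<infinity>n\<in>{axis 2 1}. T_N N n \<psi> y)"
    by (rule infsum_cong_neutral) auto
  also have "\<dots> = e_N N y * \<psi> y"
    by (simp add: T_N_def axis_def)
  finally show ?thesis .
qed

section \<open>Splitting primes and cat maps\<close>

text \<open>One Newton step for the square root doubles the precision: with \<open>w\<close> an
  inverse of \<open>2 * X\<close>, the new error is a sum of products of two multiples of
  \<open>m\<close>.\<close>

lemma sqrt_mod_square_lift:
  fixes X D m :: int
  assumes X: "[X\<^sup>2 = D] (mod m)" and cop: "coprime (2 * D) m"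
  shows "\<exists>Y. [Y\<^sup>2 = D] (mod m\<^sup>2)"
proof -
  have "coprime (X\<^sup>2) m"
    using X cop by (metis cong_imp_coprime cong_sym coprime_mult_left_iff)
  then have "coprime (2 * X) m"
    using cop by (simp add: coprime_mult_left_iff)
  then obtain w where w: "m dvd 2 * X * w - 1"
    by (auto simp: coprime_iff_invertible_int cong_iff_dvd_diff)
  have X': "m dvd X\<^sup>2 - D"
    using X by (simp add: cong_iff_dvd_diff)
  have "(X - (X\<^sup>2 - D) * w)\<^sup>2 - D
      = - ((X\<^sup>2 - D) * (2 * X * w - 1)) + ((X\<^sup>2 - D) * (X\<^sup>2 - D)) * w\<^sup>2"
    by (simp add: power2_eq_square algebra_simps)
  also have "m * m dvd \<dots>"
    by (intro dvd_add dvd_mult2 iffD2[OF dvd_minus_iff] mult_dvd_mono X' w)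
  finally show ?thesis
    by (auto simp: cong_iff_dvd_diff power2_eq_square)
qed

text \<open>As in Euclid's argument, a prime factor \<open>q\<close> of D F^2 - 1 with F = (n + 2)!
  exceeds n + 2 and does not divide \<open>D\<close>. It also makes \<open>D\<close> a square modulo
  \<open>q\<close>, with root D F. Two Newton steps lift this root to modulus q^4, which is more
  than q^3.\<close>

lemma exists_prime_sqrt_mod_cube:
  fixes D :: int and n :: nat
  assumes D: "D > 2"
  shows "\<exists>p X. prime p \<and> n < p \<and> \<not> int p dvd D \<and> [X\<^sup>2 = D] (mod int (p ^ 3))"
proof -
  define F where "F = (fact (n + 2) :: int)"
  define V where "V = D * F\<^sup>2 - 1"
  have "F \<ge> 1"
    unfolding F_def by (rule fact_ge_1)
  then have "D * 1 \<le> D * F\<^sup>2"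
    using D by (intro mult_left_mono) auto
  then have "V > 1"
    using D unfolding V_def by linarith
  then have "nat V \<noteq> 1"
    by linarith
  then obtain q :: nat where q: "prime q" "q dvd nat V"
    using prime_factor_nat by blast
  then have qV: "int q dvd V"
    using \<open>V > 1\<close> by (metis int_dvd_int_iff int_nat_eq less_le_not_le linorder_linear order_less_trans zero_less_one)
  \<comment> \<open>A prime dividing both \<open>V\<close> and V + 1 = D F^2 would divide 1, so
    \<open>q\<close> divides neither \<open>D\<close> nor \<open>F\<close>.\<close>
  have nd: "\<not> int q dvd x" if "x dvd V + 1" for x
  proof
    assume "int q dvd x"
    then have "int q dvd (V + 1) - V"
      using that qV by (meson dvd_diff dvd_trans)
    then show False
      using prime_gt_1_nat[OF q(1)] by simp
  qed
  have F: "\<not> int q dvd F" and qD: "\<not> int q dvd D"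
    by (rule nd; simp add: V_def power2_eq_square)+
  have "\<not> q dvd fact (n + 2)"
    using F unfolding F_def by (metis int_dvd_int_iff of_nat_fact)
  then have qn: "n + 2 < q"
    using prime_dvd_fact_iff[OF q(1)] by (meson not_le)
  have cop: "coprime (2 * D) (int q)"
  proof -
    have "\<not> int q dvd 2 * D"
    proof
      assume "int q dvd 2 * D"
      then have "int q dvd 2"
        using q(1) qD by (simp add: prime_dvd_mult_iff)
      then show False
        using qn zdvd_imp_le[of "int q" 2] by simp
    qed
    then show ?thesis
      using q(1) by (metis coprime_commute prime_imp_coprime prime_nat_int_transfer)
  qed
  have "(D * F)\<^sup>2 - D = D * V"
    by (simp add: V_def power2_eq_square algebra_simps)
  then have "[(D * F)\<^sup>2 = D] (mod int q)"
    using qV by (simp add: cong_iff_dvd_diff)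
  then obtain Y where "[Y\<^sup>2 = D] (mod (int q)\<^sup>2)"
    using sqrt_mod_square_lift cop by blast
  moreover have "coprime (2 * D) ((int q)\<^sup>2)"
    using cop by simp
  ultimately obtain X where "[X\<^sup>2 = D] (mod ((int q)\<^sup>2)\<^sup>2)"
    using sqrt_mod_square_lift by blast
  then have "[X\<^sup>2 = D] (mod int (q ^ 3))"
    by (rule cong_dvd_modulus) (simp add: le_imp_power_dvd flip: power_mult)
  then show ?thesis
    using q(1) qn qD by (intro exI[of _ q] exI[of _ X]) simp
qed

section \<open>Eigenvalues and norms of a cat map\<close>

lemma iota_entries:
  "iota A n m $ 1 $ 1 = n + m * A $ 1 $ 1" "iota A n m $ 1 $ 2 = m * A $ 1 $ 2"
  "iota A n m $ 2 $ 1 = m * A $ 2 $ 1" "iota A n m $ 2 $ 2 = n + m * A $ 2 $ 2"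
  by (simp_all add: iota_def matrix_matrix_mult_def mat_def sum_2)

lemma iota_0_1: "iota A 0 1 = A"
  by (simp add: vec_eq_iff forall_2 iota_entries)

lemma trace_2: "trace (A :: int^2^2) = A $ 1 $ 1 + A $ 2 $ 2"
  by (simp add: trace_def sum_2)

lemma eigenvalue_char_poly:
  assumes "det A = 1" "is_eigenvalue A \<alpha>"
  shows "\<alpha> * (of_int (trace A) - \<alpha>) = 1"
proof -
  define a b c d where "a = real_of_int (A $ 1 $ 1)" and "b = real_of_int (A $ 1 $ 2)"
    and "c = real_of_int (A $ 2 $ 1)" and "d = real_of_int (A $ 2 $ 2)"
  obtain v :: "real^2" where v: "v \<noteq> 0"
    and eq: "(\<chi> i j. real_of_int (A $ i $ j)) *v v = \<alpha> *\<^sub>R v"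
    using assms(2) by (auto simp: is_eigenvalue_def)
  have 1: "a * v $ 1 + b * v $ 2 = \<alpha> * v $ 1" "c * v $ 1 + d * v $ 2 = \<alpha> * v $ 2"
    using arg_cong[OF eq, of "\<lambda>w. w $ 1"] arg_cong[OF eq, of "\<lambda>w. w $ 2"]
    by (simp_all add: matrix_vector_mult_def sum_2 a_def b_def c_def d_def)
  have "real_of_int (A $ 1 $ 1 * A $ 2 $ 2 - A $ 1 $ 2 * A $ 2 $ 1) = 1"
    using assms(1) by (simp only: det_2 of_int_1)
  then have det: "a * d - b * c = 1"
    by (simp add: a_def b_def c_def d_def)
  have "(\<alpha> * (a + d - \<alpha>) - 1) * v $ 1 = 0" "(\<alpha> * (a + d - \<alpha>) - 1) * v $ 2 = 0"
  proof -
    \<comment> \<open>The two coordinate identities apply the adjugate of A - \<alpha>, up to sign,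
      to (A - \<alpha>)v = 0.\<close>
    have "(\<alpha> * (a + d - \<alpha>) - 1) * v $ 1 = (\<alpha> - d) * (a * v $ 1 + b * v $ 2 - \<alpha> * v $ 1)
        + b * (c * v $ 1 + d * v $ 2 - \<alpha> * v $ 2) + (a * d - b * c - 1) * v $ 1"
      by (simp add: algebra_simps)
    then show "(\<alpha> * (a + d - \<alpha>) - 1) * v $ 1 = 0"
      using 1 det by simp
    have "(\<alpha> * (a + d - \<alpha>) - 1) * v $ 2 = (\<alpha> - a) * (c * v $ 1 + d * v $ 2 - \<alpha> * v $ 2)
        + c * (a * v $ 1 + b * v $ 2 - \<alpha> * v $ 1) + (a * d - b * c - 1) * v $ 2"
      by (simp add: algebra_simps)
    then show "(\<alpha> * (a + d - \<alpha>) - 1) * v $ 2 = 0"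
      using 1 det by simp
  qed
  moreover have "v $ 1 \<noteq> 0 \<or> v $ 2 \<noteq> 0"
    using v by (auto simp: vec_eq_iff forall_2)
  ultimately show ?thesis
    by (auto simp: trace_2 a_def d_def)
qed

text \<open>Since \<alpha> and its conjugate have product 1 and sum \<open>trace A\<close>, the
  field norm is an integral quadratic form in the coordinates.\<close>

lemma norm_kernel_cong:
  assumes "det A = 1" "is_eigenvalue A \<alpha>" "(n, m) \<in> norm_kernel A \<alpha> N"
  shows "[n\<^sup>2 + n * m * trace A + m\<^sup>2 = 1] (mod int N)"
proof -
  obtain k :: int where k: "field_norm A \<alpha> n m = 1 + of_int k * of_nat N"
    using assms(3) by (auto simp: norm_kernel_def)
  have "field_norm A \<alpha> n m
      = of_int n * of_int n + of_int n * of_int m * of_int (trace A)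
        + of_int m * of_int m * (\<alpha> * (of_int (trace A) - \<alpha>))"
    by (simp add: field_norm_def order_elem_def algebra_simps)
  also have "\<dots> = of_int (n\<^sup>2 + n * m * trace A + m\<^sup>2)"
    unfolding eigenvalue_char_poly[OF assms(1,2)] by (simp add: power2_eq_square)
  finally have "real_of_int (n\<^sup>2 + n * m * trace A + m\<^sup>2) = real_of_int (1 + k * int N)"
    using k by simp
  then have "n\<^sup>2 + n * m * trace A + m\<^sup>2 = 1 + k * int N"
    by (simp only: of_int_eq_iff)
  then show ?thesis
    by (simp add: cong_iff_dvd_diff)
qed

text \<open>The three quantities vanish exactly when (0, 1), (1, 0) or (-1, 1) is an eigenvector of
  \<open>A\<close>. Its eigenvalue would be an integer dividing 1, which forces the trace to be 2 or
  -2.\<close>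

lemma hyperbolic_entries:
  fixes A :: "int^2^2"
  assumes "det A = 1" "hyperbolic A"
  shows "A $ 1 $ 2 \<noteq> 0" "A $ 2 $ 1 \<noteq> 0" "A $ 2 $ 2 - A $ 2 $ 1 - A $ 1 $ 1 + A $ 1 $ 2 \<noteq> 0"
proof -
  define a b c d where "a = A $ 1 $ 1" and "b = A $ 1 $ 2" and "c = A $ 2 $ 1" and "d = A $ 2 $ 2"
  have det: "a * d - b * c = 1"
    using assms(1) by (simp add: det_2 a_def b_def c_def d_def)
  have hyp: "\<bar>a + d\<bar> > 2"
    using assms(2) by (simp add: hyperbolic_def trace_2 a_def d_def)
  have no_root: "x * (a + d - x) \<noteq> 1" for x :: int
  proof
    assume x: "x * (a + d - x) = 1"
    then have "x = 1 \<and> a + d - x = 1 \<or> x = - 1 \<and> a + d - x = - 1"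
      by (simp add: zmult_eq_1_iff)
    then show False using hyp by auto
  qed
  have "b * c \<noteq> 0"
    using det no_root[of a] by fastforce
  then have "b \<noteq> 0" "c \<noteq> 0"
    by auto
  moreover have "d - c - a + b \<noteq> 0"
  proof
    assume root: "d - c - a + b = 0"
    have "(d - c) * (a + d - (d - c)) = (a * d - b * c) + c * (d - c - a + b)"
      by (simp add: algebra_simps)
    then have "(d - c) * (a + d - (d - c)) = 1"
      unfolding root det by simp
    then show False using no_root by blast
  qed
  ultimately show "A $ 1 $ 2 \<noteq> 0" "A $ 2 $ 1 \<noteq> 0" "A $ 2 $ 2 - A $ 2 $ 1 - A $ 1 $ 1 + A $ 1 $ 2 \<noteq> 0"
    by (simp_all add: a_def b_def c_def d_def)
qed

section \<open>Hecke eigenfunctions with large matrix elements\<close>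

text \<open>All matrices nI + mA share the eigenvector (\<tau>, 1) modulo \<open>N\<close>, with
  eigenvalue u = n + m lam, and the condition on \<open>\<gamma>\<close> for \<open>A\<close>
  carries over to them by multiplication with \<open>m\<close>. One transform therefore serves all
  Hecke operators, its eigenvalue being \<open>\<phi> u\<close> up to a scalar from Gauss
  sums.\<close>

lemma hecke_eigenfunction_chirp:
  fixes A :: "int^2^2" and N :: nat
  assumes A: "det A = 1" "is_eigenvalue A \<alpha>"
    and p: "prime p" "odd p" and N: "N = p ^ 3"
    and lam: "[lam + lam' = trace A] (mod int N)" "[lam * lam' = 1] (mod int N)"
    and \<tau>: "[A $ 2 $ 1 * \<tau> + A $ 2 $ 2 = lam] (mod int N)" "[A $ 1 $ 1 * \<tau> + A $ 1 $ 2 = lam * \<tau>] (mod int N)"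
    and \<tau>_unit: "\<not> int p dvd \<tau>" "\<not> int p dvd 1 + \<tau>"
    and h: "[2 * h = 1] (mod int N)"
    and \<gamma>: "[\<gamma> * (lam - lam') = h * A $ 2 $ 1] (mod int N)"
    and per: "\<And>x y. [x = y] (mod int N) \<Longrightarrow> \<phi> x = \<phi> y"
    and mult: "\<And>x y. \<phi> (x * y) = \<phi> x * \<phi> y" and one: "\<phi> 1 = 1"
    and nz: "\<exists>x. r * chirp N (h * \<tau>) 1 \<gamma> \<phi> x \<noteq> 0"
  shows "hecke_eigenfunction A \<alpha> N (\<lambda>x. r * chirp N (h * \<tau>) 1 \<gamma> \<phi> x)"
proof -
  have N0: "N > 0" and oddN: "odd N"
    using p prime_gt_0_nat[OF p(1)] by (simp_all add: N)
  have pN: "int p dvd int N" by (simp add: N)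
  define \<Psi> where "\<Psi> = (\<lambda>x. r * chirp N (h * \<tau>) 1 \<gamma> \<phi> x)"
  have eigen: "eigenfunction (U_N N (iota A n m)) \<Psi>"
    if nm: "[n\<^sup>2 + n * m * trace A + m\<^sup>2 = 1] (mod int N)" for n m
  proof -
    define g where "g = iota A n m"
    define u v where "u = n + m * lam" and "v = n + m * lam'"
    define s where "s = (LEAST s. coprime (g $ 2 $ 2 - g $ 2 $ 1 * int s) (int N))"
    note dvds = lam[unfolded cong_iff_dvd_diff] \<tau>[unfolded cong_iff_dvd_diff]
      \<gamma>[unfolded cong_iff_dvd_diff] nm[unfolded cong_iff_dvd_diff]
    have "u * v - 1 = m\<^sup>2 * (lam * lam' - 1) + n * m * (lam + lam' - trace A)
        + 1 * (n\<^sup>2 + n * m * trace A + m\<^sup>2 - 1)"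
      by (simp add: u_def v_def power2_eq_square algebra_simps)
    also have "int N dvd \<dots>"
      using dvds by (intro dvd_add dvd_mult)
    finally have uv: "[u * v = 1] (mod int N)"
      by (simp add: cong_iff_dvd_diff)
    have "g $ 2 $ 1 * \<tau> + g $ 2 $ 2 - u = m * (A $ 2 $ 1 * \<tau> + A $ 2 $ 2 - lam)"
      by (simp add: g_def iota_entries u_def algebra_simps)
    then have u: "[g $ 2 $ 1 * \<tau> + g $ 2 $ 2 = u] (mod int N)"
      using dvds by (simp add: cong_iff_dvd_diff)
    have "g $ 1 $ 1 * \<tau> + g $ 1 $ 2 - u * \<tau> = m * (A $ 1 $ 1 * \<tau> + A $ 1 $ 2 - lam * \<tau>)"
      by (simp add: g_def iota_entries u_def algebra_simps)
    then have ut: "[g $ 1 $ 1 * \<tau> + g $ 1 $ 2 = u * \<tau>] (mod int N)"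
      using dvds by (simp add: cong_iff_dvd_diff)
    have "g $ 1 $ 1 - g $ 2 $ 1 * \<tau> - v = - m * (A $ 2 $ 1 * \<tau> + A $ 2 $ 2 - lam)
        + - m * (lam + lam' - trace A)"
      by (simp add: g_def iota_entries v_def trace_2 algebra_simps)
    also have "int N dvd \<dots>"
      using dvds by (intro dvd_add dvd_mult)
    finally have v: "[g $ 1 $ 1 - g $ 2 $ 1 * \<tau> = v] (mod int N)"
      by (simp add: cong_iff_dvd_diff)
    have "\<gamma> * (u - v) - h * g $ 2 $ 1 = m * (\<gamma> * (lam - lam') - h * A $ 2 $ 1)"
      by (simp add: g_def iota_entries u_def v_def algebra_simps)
    then have \<gamma>': "[\<gamma> * (u - v) = h * g $ 2 $ 1] (mod int N)"
      using dvds by (simp add: cong_iff_dvd_diff)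
    \<comment> \<open>If \<open>p\<close> divided both numbers, it would divide the bottom row of
      \<open>g\<close> and hence the unit \<open>u\<close>. So the parameter \<open>s\<close> in
      \<open>U_N\<close> is 0 or 1, and the invertibility of \<tau> and 1 + \<tau> covers both
      cases.\<close>
    have *: "coprime (g $ 2 $ 2 - g $ 2 $ 1 * int 0) (int N) \<or> coprime (g $ 2 $ 2 - g $ 2 $ 1 * int 1) (int N)"
    proof (rule ccontr)
      assume "\<not> ?thesis"
      then have "int p dvd g $ 2 $ 2" "int p dvd g $ 2 $ 2 - g $ 2 $ 1"
        unfolding N coprime_prime_cube_iff[OF p(1)] by simp_all
      then have "int p dvd g $ 2 $ 2" "int p dvd g $ 2 $ 1"
        using dvd_diff[of "int p" "g $ 2 $ 2" "g $ 2 $ 2 - g $ 2 $ 1"] by simp_all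
      then have "int p dvd g $ 2 $ 1 * \<tau> + g $ 2 $ 2"
        by simp
      then have "int p dvd u"
        using u pN by (metis cong_dvd_iff cong_dvd_modulus)
      then have "int p dvd 1"
        using uv pN by (metis cong_dvd_iff cong_dvd_modulus dvd_mult2)
      then show False
        using prime_gt_1_nat[OF p(1)] by simp
    qed
    then have e: "coprime (g $ 2 $ 2 - g $ 2 $ 1 * int s) (int N)"
      unfolding s_def by (rule disjE) (erule LeastI)+
    have "s \<le> 1"
      using * unfolding s_def by (rule disjE) (blast intro: Least_le order_trans[OF Least_le])+
    then have "s = 0 \<or> s = 1" by auto
    then have Q: "coprime (int s + \<tau>) (int N)"
      unfolding N coprime_prime_cube_iff[OF p(1)] using \<tau>_unit by auto
    obtain k where k: "U_N N g (chirp N (h * \<tau>) 1 \<gamma> \<phi>) = (\<lambda>x. k * chirp N (h * \<tau>) v (\<gamma> * v\<^sup>2) \<phi> x)"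
      using U_N_chirp[OF oddN, of g \<tau> h u v \<gamma> \<phi>] e Q h u ut v uv \<gamma>' unfolding s_def by blast
    have "U_N N g \<Psi> x = (k * \<phi> u) * \<Psi> x" for x
      unfolding \<Psi>_def U_N_scale k
      using chirp_multiplicative[where \<phi> = \<phi>, OF N0 per mult one uv] by simp
    moreover have "\<exists>x. \<Psi> x \<noteq> 0"
      using nz by (simp add: \<Psi>_def)
    ultimately show ?thesis
      unfolding eigenfunction_def g_def by blast
  qed
  have "eigenfunction (U_N N A) \<Psi>"
    using eigen[of 0 1] by (simp add: iota_0_1)
  moreover have "eigenfunction (U_N N (iota A n m)) \<Psi>" if "(n, m) \<in> norm_kernel A \<alpha> N" for n m
    using eigen norm_kernel_cong[OF A that] by blast
  moreover have "\<Psi> \<in> hilbert N"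
  proof -
    have "\<Psi> (y + int N) = \<Psi> y" for y
      unfolding \<Psi>_def
      by (rule arg_cong[where f = "(*) r"], rule chirp_cong[OF N0]) (simp_all add: cong_iff_dvd_diff)
    then show ?thesis by (simp add: hilbert_def)
  qed
  ultimately show ?thesis
    unfolding hecke_eigenfunction_def \<Psi>_def[symmetric] by auto
qed

text \<open>By the correlation formula, the squared norm is the number \<open>M\<close> of units
  modulo p^3, and the matrix element is a sum of modulus p^2. After normalization the latter becomes
  p^2/M, where M is at most p^3.\<close>

lemma chirp_log_char_inner:
  fixes p :: nat and K \<alpha> \<gamma> :: int
  defines "N \<equiv> p ^ 3" and "\<Phi> \<equiv> chirp (p ^ 3) \<alpha> 1 \<gamma> (log_char p K)"
  assumes p: "prime p" "odd p" and \<gamma>: "\<not> int p dvd 2 * \<gamma>"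
    and K: "[4 * K * (int p - 1) = - (2 * \<gamma>)] (mod int N)"
  shows "\<exists>r. inner_N N (\<lambda>x. r * \<Phi> x) (\<lambda>x. r * \<Phi> x) = 1
    \<and> cmod (inner_N N (\<lambda>x. e_N N x * (r * \<Phi> x)) (\<lambda>x. r * \<Phi> x)) \<ge> 1 / real p"
proof -
  define \<phi> where "\<phi> = log_char p K"
  have p0: "p > 0" "p > 1" using p(1) prime_gt_0_nat prime_gt_1_nat by auto
  have N0: "N > 0" using p0 by (simp add: N_def)
  have per: "\<phi> x = \<phi> y" if "[x = y] (mod int N)" for x y
    using log_char_cong[OF p(1)] that by (simp add: \<phi>_def N_def)
  have corr: "(\<Sum>x\<in>{0..<int N}. e_N N (k * x) * (\<Phi> x * cnj (\<Phi> x)))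
    = of_nat N * (\<Sum>y\<in>{0..<int N}. e_N N (\<gamma> * (y\<^sup>2 - (y + k)\<^sup>2)) * (\<phi> y * cnj (\<phi> (y + k))))" for k
    unfolding \<Phi>_def \<phi>_def[symmetric] N_def[symmetric] by (rule chirp_correlation[OF N0 per])
  define M where "M = card {y \<in> {0..<int N}. \<not> int p dvd y}"
  have "M \<le> card {0..<int N}"
    unfolding M_def by (intro card_mono) auto
  then have M_le: "M \<le> p ^ 3"
    by (simp add: N_def nat_power_eq)
  have "int N > 1"
    using p0 by (simp add: N_def)
  then have "1 \<in> {y \<in> {0..<int N}. \<not> int p dvd y}"
    using p0 by simp
  moreover have "finite {y \<in> {0..<int N}. \<not> int p dvd y}"
    by (rule finite_subset[of _ "{0..<int N}"]) auto
  ultimately have M_pos: "M > 0"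
    unfolding M_def by (metis card_gt_0_iff empty_iff)
  have sum_sq: "(\<Sum>y\<in>{0..<int N}. \<phi> y * cnj (\<phi> y)) = of_nat M"
  proof -
    have "\<phi> y * cnj (\<phi> y) = (if \<not> int p dvd y then 1 else 0)" for y
      by (simp add: \<phi>_def norm_log_char flip: complex_norm_square)
    then have "(\<Sum>y\<in>{0..<int N}. \<phi> y * cnj (\<phi> y)) = (\<Sum>y\<in>{0..<int N}. if \<not> int p dvd y then 1 else 0)"
      by simp
    also have "\<dots> = (\<Sum>y\<in>{y \<in> {0..<int N}. \<not> int p dvd y}. 1)"
      by (rule sum.inter_filter[symmetric]) simp
    finally show ?thesis by (simp add: M_def)
  qed
  define S where "S = (\<Sum>y\<in>{0..<int N}. e_N N (\<gamma> * (y\<^sup>2 - (y + 1)\<^sup>2)) * (\<phi> y * cnj (\<phi> (y + 1))))"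
  have norm_S: "cmod S = (real p)\<^sup>2"
  proof -
    \<comment> \<open>The difference of squares is linear in \<open>y\<close>, which puts the sum
      into the form of \<open>log_char_sum\<close> with \<theta> = 2\<gamma>.\<close>
    have "\<gamma> * (y\<^sup>2 - (y + 1)\<^sup>2) = - \<gamma> + - (2 * \<gamma>) * y" for y
      by (simp add: power2_eq_square algebra_simps)
    then have "S = e_N N (- \<gamma>) * (\<Sum>y\<in>{0..<int N}. e_N N (- (2 * \<gamma>) * y) * (\<phi> y * cnj (\<phi> (y + 1))))"
      by (simp only: S_def e_N_add sum_distrib_left mult.assoc)
    then show ?thesis
      using log_char_sum[OF p \<gamma> K[unfolded N_def]] by (simp add: norm_mult \<phi>_def N_def)
  qed
  define r where "r = complex_of_real (1 / sqrt (real M))"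
  have rr: "r * cnj r = 1 / of_nat M"
    using M_pos by (simp add: r_def flip: of_real_mult)
  have inner: "inner_N N (\<lambda>x. e_N N (k * x) * (r * \<Phi> x)) (\<lambda>x. r * \<Phi> x)
     = r * cnj r * (\<Sum>y\<in>{0..<int N}. e_N N (\<gamma> * (y\<^sup>2 - (y + k)\<^sup>2)) * (\<phi> y * cnj (\<phi> (y + k))))" for k
  proof -
    have "inner_N N (\<lambda>x. e_N N (k * x) * (r * \<Phi> x)) (\<lambda>x. r * \<Phi> x)
      = (1 / of_nat N) * (r * cnj r * (\<Sum>x\<in>{0..<int N}. e_N N (k * x) * (\<Phi> x * cnj (\<Phi> x))))"
      by (simp add: inner_N_def sum_distrib_left mult_ac)
    then show ?thesis
      unfolding corr using N0 by simp
  qed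
  have "inner_N N (\<lambda>x. r * \<Phi> x) (\<lambda>x. r * \<Phi> x) = 1"
    using inner[of 0] sum_sq M_pos by (simp add: rr)
  moreover have "1 / real p \<le> cmod (inner_N N (\<lambda>x. e_N N x * (r * \<Phi> x)) (\<lambda>x. r * \<Phi> x))"
  proof -
    have "real M \<le> real p * (real p)\<^sup>2"
      using M_le by (metis of_nat_le_iff of_nat_mult of_nat_power power2_eq_square power3_eq_cube mult.assoc)
    then have "1 / real p \<le> (real p)\<^sup>2 / real M"
      using M_pos p0 by (simp add: field_simps)
    then show ?thesis
      using inner[of 1] norm_S by (simp add: rr S_def norm_mult norm_divide)
  qed
  ultimately show ?thesis by blast
qed

lemma exists_localized_hecke_eigenfunction:
  fixes A :: "int^2^2" and \<alpha> :: real and n :: nat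
  assumes A: "det A = 1" "hyperbolic A" "is_eigenvalue A \<alpha>"
  shows "\<exists>p \<psi>. prime p \<and> odd p \<and> n < p \<and> hecke_eigenfunction A \<alpha> (p ^ 3) \<psi>
    \<and> inner_N (p ^ 3) \<psi> \<psi> = 1
    \<and> 1 / real p \<le> cmod (inner_N (p ^ 3) (\<lambda>x. e_N (p ^ 3) x * \<psi> x) \<psi>)"
proof -
  define a b c d where "a = A $ 1 $ 1" and "b = A $ 1 $ 2" and "c = A $ 2 $ 1" and "d = A $ 2 $ 2"
  define t where "t = trace A"
  have t: "t = a + d"
    by (simp add: t_def trace_2 a_def d_def)
  have det: "a * d - b * c = 1"
    using A(1) by (simp add: det_2 a_def b_def c_def d_def)
  \<comment> \<open>Modulo \<open>p\<close>, \<tau> = 0 would force \<open>p\<close> to divide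
    \<open>b\<close>, and \<tau> = -1 would force it to divide \<open>R\<close>. Invertibility of
    \<open>c\<close> makes an eigenvector of the form (\<tau>, 1) available.\<close>
  define R where "R = d - c - a + b"
  have nz: "b \<noteq> 0" "c \<noteq> 0" "R \<noteq> 0"
    using hyperbolic_entries[OF A(1,2)] by (simp_all add: R_def a_def b_def c_def d_def)
  have "3 * 3 \<le> \<bar>t\<bar> * \<bar>t\<bar>"
    using A(2) by (intro mult_mono) (auto simp: hyperbolic_def t_def)
  then have "t\<^sup>2 - 4 > 2"
    by (simp add: power2_eq_square)
  \<comment> \<open>The discriminant of the characteristic polynomial gets the root \<open>X\<close>
    modulo p^3. The size of \<open>p\<close> makes it odd and makes \<open>b\<close>,
    \<open>c\<close> and \<open>R\<close> units.\<close>
  then obtain p X where p: "prime p" and pn: "n + nat \<bar>b\<bar> + nat \<bar>c\<bar> + nat \<bar>R\<bar> + 2 < p"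
    and pD: "\<not> int p dvd t\<^sup>2 - 4" and X: "[X\<^sup>2 = t\<^sup>2 - 4] (mod int (p ^ 3))"
    using exists_prime_sqrt_mod_cube by blast
  define N where "N = p ^ 3"
  have p0: "p > 1" using prime_gt_1_nat[OF p] .
  have pN: "int p dvd int N" by (simp add: N_def)
  have odd_p: "odd p"
    using p pn prime_odd_nat by auto
  have small: "\<not> int p dvd x" if "x \<noteq> 0" "nat \<bar>x\<bar> < p" for x
  proof
    assume "int p dvd x"
    then have "int p \<le> \<bar>x\<bar>"
      using dvd_imp_le_int[OF that(1)] by fastforce
    then show False
      using that(2) by simp
  qed
  have pb: "\<not> int p dvd b" and pc: "\<not> int p dvd c" and pR: "\<not> int p dvd R" and p2: "\<not> int p dvd 2"
    by (rule small; use pn nz in auto)+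
  have unit: "\<exists>y. int N dvd x * y - 1" if "\<not> int p dvd x" for x
  proof -
    have "coprime x (int N)"
      unfolding N_def coprime_prime_cube_iff[OF p] by (rule that)
    then show ?thesis
      by (auto simp: coprime_iff_invertible_int cong_iff_dvd_diff)
  qed
  have not_p_dvd_inverse: "\<not> int p dvd y" if "int N dvd x * y - 1" for x y
  proof
    assume "int p dvd y"
    then have "int p dvd x * y - (x * y - 1)"
      using that pN by (meson dvd_diff dvd_mult dvd_trans)
    then show False
      using p0 by simp
  qed
  have X': "int N dvd X\<^sup>2 - (t\<^sup>2 - 4)"
    using X by (simp add: cong_iff_dvd_diff N_def)
  have pX: "\<not> int p dvd X"
  proof
    assume "int p dvd X"
    then have "int p dvd X\<^sup>2 - (X\<^sup>2 - (t\<^sup>2 - 4))"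
      using X' pN by (meson dvd_diff dvd_mult dvd_trans power2_eq_square dvd_power zero_less_numeral)
    then show False
      using pD by simp
  qed
  obtain h where h: "int N dvd 2 * h - 1" using unit[OF p2] by blast
  obtain ci where ci: "int N dvd c * ci - 1" using unit[OF pc] by blast
  obtain Xi where Xi: "int N dvd X * Xi - 1" using unit[OF pX] by blast
  \<comment> \<open>These are the eigenvalues (t + X)/2 and (t - X)/2 modulo \<open>N\<close>. Then
    \<tau> = (lam - d)/c solves the bottom row of the eigenvector equation, and \<gamma> = c/(2X)
    solves its condition because lam - lam' = X.\<close>
  define lam lam' where "lam = h * (t + X)" and "lam' = h * (t - X)"
  define \<tau> where "\<tau> = ci * (lam - d)"
  define \<gamma> where "\<gamma> = h * c * Xi"
  have "lam + lam' - t = t * (2 * h - 1)"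
    by (simp add: lam_def lam'_def algebra_simps)
  then have lam_sum: "int N dvd lam + lam' - t"
    using h by simp
  have "lam * lam' - 1 = (2 * h + 1) * (2 * h - 1) + - (h\<^sup>2) * (X\<^sup>2 - (t\<^sup>2 - 4))"
    by (simp add: lam_def lam'_def power2_eq_square algebra_simps)
  also have "int N dvd \<dots>"
    by (rule dvd_add[OF dvd_mult[OF h] dvd_mult[OF X']])
  finally have lam_prod: "int N dvd lam * lam' - 1" .
  have "c * \<tau> + d - lam = (lam - d) * (c * ci - 1)"
    by (simp add: \<tau>_def algebra_simps)
  then have tau1: "int N dvd c * \<tau> + d - lam"
    using ci by simp
  have tau2: "int N dvd a * \<tau> + b - lam * \<tau>"
  proof -
    have "a * \<tau> + b - lam * \<tau> = (- b) * (c * ci - 1) + ci * (a * (lam - d) + b * c - lam * (lam - d))"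
      by (simp add: \<tau>_def algebra_simps)
    \<comment> \<open>The top row of the eigenvector equation reduces to the characteristic equation
      of \<open>lam\<close>.\<close>
    also have "a * (lam - d) + b * c - lam * (lam - d)
        = lam * (t - lam) - (a * d - b * c)"
      by (simp add: t algebra_simps)
    also have "\<dots> = (lam * lam' - 1) + (- lam) * (lam + lam' - t)"
      unfolding det by (simp add: algebra_simps)
    also have "int N dvd (- b) * (c * ci - 1) + ci * ((lam * lam' - 1) + (- lam) * (lam + lam' - t))"
      by (rule dvd_add[OF dvd_mult[OF ci] dvd_mult[OF dvd_add[OF lam_prod dvd_mult[OF lam_sum]]]])
    finally show ?thesis .
  qed
  note p_tau = dvd_trans[OF pN tau1] dvd_trans[OF pN tau2]
  have tau_unit: "\<not> int p dvd \<tau>"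
  proof
    assume "int p dvd \<tau>"
    then have "int p dvd (a * \<tau> + b - lam * \<tau>) - (a - lam) * \<tau>"
      by (rule dvd_diff[OF p_tau(2) dvd_mult])
    then show False
      using pb by (simp add: algebra_simps)
  qed
  have tau_unit': "\<not> int p dvd 1 + \<tau>"
  proof
    assume "int p dvd 1 + \<tau>"
    then have "int p dvd ((c * \<tau> + d - lam) + (a * \<tau> + b - lam * \<tau>)) - (c + a - lam) * (1 + \<tau>)"
      by (rule dvd_diff[OF dvd_add[OF p_tau] dvd_mult])
    moreover have "((c * \<tau> + d - lam) + (a * \<tau> + b - lam * \<tau>)) - (c + a - lam) * (1 + \<tau>) = R"
      by (simp add: R_def algebra_simps)
    ultimately show False
      using pR by simp
  qed
  have gamma: "int N dvd \<gamma> * (lam - lam') - h * c"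
  proof -
    have "\<gamma> * (lam - lam') - h * c = (h * c * Xi * X) * (2 * h - 1) + (h * c) * (X * Xi - 1)"
      by (simp add: \<gamma>_def lam_def lam'_def algebra_simps)
    also have "int N dvd \<dots>"
      by (rule dvd_add[OF dvd_mult[OF h] dvd_mult[OF Xi]])
    finally show ?thesis .
  qed
  have gamma_unit: "\<not> int p dvd 2 * \<gamma>"
    using p2 pc not_p_dvd_inverse[OF h] not_p_dvd_inverse[OF Xi] p
    by (auto simp: \<gamma>_def prime_dvd_mult_iff)
  have "\<not> int p dvd int p - 1"
  proof
    assume "int p dvd int p - 1"
    then have "int p dvd int p - (int p - 1)"
      by (rule dvd_diff[OF dvd_refl])
    then show False using p0 by simp
  qed
  then have "\<not> int p dvd 2 * (2 * (int p - 1))"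
    using p2 p by (simp only: prime_dvd_mult_iff prime_nat_int_transfer) blast
  then obtain j where j: "int N dvd 2 * (2 * (int p - 1)) * j - 1"
    using unit by blast
  \<comment> \<open>With \<open>j\<close> an inverse of 4(p - 1), this is the frequency for which
    the two critical points of the correlation phase coincide.\<close>
  define K where "K = - (2 * \<gamma>) * j"
  have "4 * K * (int p - 1) - (- (2 * \<gamma>)) = - (2 * \<gamma>) * (2 * (2 * (int p - 1)) * j - 1)"
    by (simp add: K_def algebra_simps)
  also have "int N dvd \<dots>"
    by (rule dvd_mult[OF j])
  finally have K: "[4 * K * (int p - 1) = - (2 * \<gamma>)] (mod int (p ^ 3))"
    by (simp add: cong_iff_dvd_diff N_def)
  define \<Phi> where "\<Phi> = chirp N (h * \<tau>) 1 \<gamma> (log_char p K)"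
  obtain r where r: "inner_N N (\<lambda>x. r * \<Phi> x) (\<lambda>x. r * \<Phi> x) = 1"
    "1 / real p \<le> cmod (inner_N N (\<lambda>x. e_N N x * (r * \<Phi> x)) (\<lambda>x. r * \<Phi> x))"
    using chirp_log_char_inner[OF p odd_p gamma_unit K, of "h * \<tau>"] unfolding \<Phi>_def N_def by blast
  have "\<exists>x. r * \<Phi> x \<noteq> 0"
  proof (rule ccontr)
    assume "\<not> ?thesis"
    then have zero: "(\<lambda>x. r * \<Phi> x) = (\<lambda>x. 0)"
      by blast
    show False
      using r(1) unfolding zero by (simp add: inner_N_def)
  qed
  then have nonzero: "\<exists>x. r * chirp N (h * \<tau>) 1 \<gamma> (log_char p K) x \<noteq> 0"
    by (simp only: \<Phi>_def)
  have "hecke_eigenfunction A \<alpha> N (\<lambda>x. r * \<Phi> x)"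
    unfolding \<Phi>_def
  proof (rule hecke_eigenfunction_chirp[OF A(1,3) p odd_p N_def _ _ _ _ tau_unit tau_unit' _ _ _ _ _ nonzero])
    show "[lam + lam' = trace A] (mod int N)" "[lam * lam' = 1] (mod int N)" "[2 * h = 1] (mod int N)"
      using lam_sum lam_prod h by (simp_all add: cong_iff_dvd_diff t_def)
    show "[A $ 2 $ 1 * \<tau> + A $ 2 $ 2 = lam] (mod int N)" "[A $ 1 $ 1 * \<tau> + A $ 1 $ 2 = lam * \<tau>] (mod int N)"
      "[\<gamma> * (lam - lam') = h * A $ 2 $ 1] (mod int N)"
      using tau1 tau2 gamma by (simp_all add: cong_iff_dvd_diff a_def b_def c_def d_def)
    show "log_char p K x = log_char p K y" if "[x = y] (mod int N)" for x y
      using log_char_cong[OF p] that by (simp add: N_def)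
    show "log_char p K (x * y) = log_char p K x * log_char p K y" for x y
      by (rule log_char_mult[OF p odd_p])
    show "log_char p K 1 = 1"
      by (rule log_char_1[OF p])
  qed
  then show ?thesis
    using p odd_p pn r unfolding N_def by (intro exI[of _ p] exI[of _ "\<lambda>x. r * \<Phi> x"]) auto
qed

theorem theorem2:
  fixes A :: "int^2^2" and \<alpha> :: real
  assumes "det A = 1" and "hyperbolic A" and "is_eigenvalue A \<alpha>"
  shows "\<exists>f :: real^2 \<Rightarrow> complex. torus_smooth f \<and>
    (\<exists>(N :: nat \<Rightarrow> nat) (\<psi> :: nat \<Rightarrow> int \<Rightarrow> complex).
       filterlim N at_top sequentially \<and>
       (\<forall>k. odd (N k)) \<and>
       (\<forall>k. hecke_eigenfunction A \<alpha> (N k) (\<psi> k) \<and> inner_N (N k) (\<psi> k) (\<psi> k) = 1) \<and>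
       (\<exists>c::real. c > 0 \<and>
         (\<forall>k. cmod (inner_N (N k) (Op_N (N k) f (\<psi> k)) (\<psi> k) - torus_integral f)
                \<ge> c * real (N k) powr (- 1 / 3))))"
proof -
  define Q where "Q k p \<psi> \<longleftrightarrow> prime p \<and> odd p \<and> k < p \<and> hecke_eigenfunction A \<alpha> (p ^ 3) \<psi>
    \<and> inner_N (p ^ 3) \<psi> \<psi> = 1 \<and> 1 / real p \<le> cmod (inner_N (p ^ 3) (\<lambda>x. e_N (p ^ 3) x * \<psi> x) \<psi>)"
    for k p \<psi>
  have "\<exists>p \<psi>. Q k p \<psi>" for k
    unfolding Q_def by (rule exists_localized_hecke_eigenfunction[OF assms])
  then obtain p \<psi> where "\<And>k. Q k (p k) (\<psi> k)"
    by metis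
  note p\<psi> = this[unfolded Q_def]
  define f :: "real^2 \<Rightarrow> complex" where "f = (\<lambda>x. cis (2 * pi * x $ 2))"
  have "filterlim (\<lambda>k. p k ^ 3) at_top sequentially"
  proof (rule filterlim_at_top_mono[OF filterlim_ident])
    have "k \<le> p k ^ 3" for k
      using p\<psi>[of k] by (intro order_trans[OF less_imp_le self_le_power]) (auto intro: prime_ge_1_nat)
    then show "\<forall>\<^sub>F k in sequentially. k \<le> p k ^ 3" by simp
  qed
  moreover have "1 * real (p k ^ 3) powr (- 1 / 3)
      \<le> cmod (inner_N (p k ^ 3) (Op_N (p k ^ 3) f (\<psi> k)) (\<psi> k) - torus_integral f)" for k
  proof -
    have pos: "real (p k) > 0"
      using p\<psi>[of k] by (simp add: prime_gt_0_nat)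
    \<comment> \<open>With N = p^3, the bound 1/p is exactly N to the power -1/3, so the constant 1
      suffices.\<close>
    then have "real (p k ^ 3) powr (- 1 / 3) = (real (p k) powr 3) powr (- 1 / 3)"
      by (simp only: of_nat_power powr_numeral)
    also have "\<dots> = 1 / real (p k)"
      using pos unfolding powr_powr by (simp add: powr_minus_divide)
    finally have "real (p k ^ 3) powr (- 1 / 3) = 1 / real (p k)" .
    moreover have "Op_N (p k ^ 3) f (\<psi> k) = (\<lambda>x. e_N (p k ^ 3) x * \<psi> k x)"
      unfolding f_def by (rule ext) (rule Op_N_character)
    ultimately show ?thesis
      using p\<psi>[of k] by (simp add: f_def torus_integral_character_2)
  qed
  moreover have "torus_smooth f"
    unfolding f_def by (rule torus_smooth_character)
  ultimately show ?thesis
    using p\<psi>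
    by (intro exI[of _ f] conjI exI[of _ "\<lambda>k. p k ^ 3"] exI[of _ \<psi>] exI[of _ "1::real"] allI)
       (simp_all only: even_power zero_less_one simp_thms)
qed

end
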